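(* Let $G$ be a Polish group. The point transitive $G$-projective flows are, up to isomorphism, exactly the $G$-flows of the form $\mathrm{Sa}(G)\cdot\rho$ for an idempotent $\rho\in\mathrm{Sa}(G)$.
   Context: A $G$-flow is a (nonempty) compact Hausdorff space with a continuous left action of $G$; a $G$-map is a continuous $G$-equivariant map. A flow is point transitive if it has a point with dense orbit. A $G$-flow $X$ is $G$-projective if for all $G$-flows $Y,Z$, every $G$-map $\phi\colon X\to Y$ and every surjective $G$-map $\pi\colon Z\to Y$, there is a $G$-map $\psi\colon X\to Z$ with $\pi\circ\psi=\phi$. $\mathrm{Sa}(G)$ is the Samuel compactification of $G$: the Gelfand spectrum of the $C^*$-algebra of bounded functions $f\colon G\to\mathbb{C}$ such that for every $\varepsilon>0$ there is an open neighbourhood $U$ of $1_G$ with $|f(ug)-f(g)|<\varepsilon$ for all $u\in U$, $g\in G$. It is a $G$-flow containing $G$ as a dense subset; for every $G$-flow $X$ and $x\in X$ there is a unique $G$-map $\mathrm{Sa}(G)\to X$ with $g\mapsto gx$, written $p\mapsto px$. Taking $X=\mathrm{Sa}(G)$ gives a semigroup operation on $\mathrm{Sa}(G)$ making it a compact right topological semigroup: for each $q\in \mathrm{Sa}(G)$ the map $p\mapsto p\cdot q$ is continuous. An idempotent is $\rho$ with $\rho\cdot\rho=\rho$, and $\mathrm{Sa}(G)\cdot\rho=\{p\cdot\rho:p\in\mathrm{Sa}(G)\}$, a subflow of $\mathrm{Sa}(G)$. *)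

theory Defs
  imports "HOL-Analysis.Analysis" "HOL-Algebra.Group" "HOL-Library.Equipollence"
begin

section \<open>Polish groups and flows\<close>

record 'g topgroup = "'g monoid" +
  grp_top :: "'g topology"

definition topological_group :: "('g, 'm) topgroup_scheme \<Rightarrow> bool" where
  "topological_group G \<longleftrightarrow>
     group G \<and> topspace (grp_top G) = carrier G \<and>
     continuous_map (prod_topology (grp_top G) (grp_top G)) (grp_top G) (\<lambda>(g, h). g \<otimes>\<^bsub>G\<^esub> h) \<and>
     continuous_map (grp_top G) (grp_top G) (\<lambda>g. inv\<^bsub>G\<^esub> g)"

definition polish_group :: "('g, 'm) topgroup_scheme \<Rightarrow> bool" where
  "polish_group G \<longleftrightarrow>
     topological_group G \<and> separable_space (grp_top G) \<and> completely_metrizable_space (grp_top G)"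

record ('g, 'x) flow =
  flow_top :: "'x topology"
  flow_act :: "'g \<Rightarrow> 'x \<Rightarrow> 'x"

abbreviation points :: "('g, 'x) flow \<Rightarrow> 'x set" where
  "points X \<equiv> topspace (flow_top X)"

text \<open>Nothing is required of \<open>flow_act X g x\<close> for \<open>g\<close> outside the carrier of the group or \<open>x\<close>
  outside \<open>points X\<close>.\<close>

definition G_flow :: "('g, 'm) topgroup_scheme \<Rightarrow> ('g, 'x) flow \<Rightarrow> bool" where
  "G_flow G X \<longleftrightarrow>
     points X \<noteq> {} \<and> compact_space (flow_top X) \<and> Hausdorff_space (flow_top X) \<and>
     continuous_map (prod_topology (grp_top G) (flow_top X)) (flow_top X) (\<lambda>(g, x). flow_act X g x) \<and>
     (\<forall>x\<in>points X. flow_act X \<one>\<^bsub>G\<^esub> x = x) \<and>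
     (\<forall>g\<in>carrier G. \<forall>h\<in>carrier G. \<forall>x\<in>points X.
        flow_act X (g \<otimes>\<^bsub>G\<^esub> h) x = flow_act X g (flow_act X h x))"

definition G_map ::
  "('g, 'm) topgroup_scheme \<Rightarrow> ('g, 'x) flow \<Rightarrow> ('g, 'y) flow \<Rightarrow> ('x \<Rightarrow> 'y) \<Rightarrow> bool" where
  "G_map G X Y \<phi> \<longleftrightarrow>
     continuous_map (flow_top X) (flow_top Y) \<phi> \<and>
     (\<forall>g\<in>carrier G. \<forall>x\<in>points X. \<phi> (flow_act X g x) = flow_act Y g (\<phi> x))"

definition flow_isomorphic ::
  "('g, 'm) topgroup_scheme \<Rightarrow> ('g, 'x) flow \<Rightarrow> ('g, 'y) flow \<Rightarrow> bool" where
  "flow_isomorphic G X Y \<longleftrightarrow>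
     (\<exists>\<phi> \<psi>. G_map G X Y \<phi> \<and> G_map G Y X \<psi> \<and>
            (\<forall>x\<in>points X. \<psi> (\<phi> x) = x) \<and> (\<forall>y\<in>points Y. \<phi> (\<psi> y) = y))"

definition point_transitive :: "('g, 'm) topgroup_scheme \<Rightarrow> ('g, 'x) flow \<Rightarrow> bool" where
  "point_transitive G X \<longleftrightarrow>
     (\<exists>x\<in>points X. flow_top X closure_of ((\<lambda>g. flow_act X g x) ` carrier G) = points X)"

text \<open>HOL cannot quantify over all flows of all types inside a formula.  The lifting property is
  therefore relative to a type \<open>'u\<close> playing the role of a universe: the test flows \<open>Y\<close> and \<open>Z\<close>
  have their points in \<open>'u\<close>.\<close>

definition G_projective ::
  "'u itself \<Rightarrow> ('g, 'm) topgroup_scheme \<Rightarrow> ('g, 'x) flow \<Rightarrow> bool" where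
  "G_projective U G X \<longleftrightarrow>
     (\<forall>(Y :: ('g, 'u) flow) (Z :: ('g, 'u) flow) \<phi> \<pi>.
        G_flow G Y \<and> G_flow G Z \<and> G_map G X Y \<phi> \<and> G_map G Z Y \<pi> \<and> \<pi> ` points Z = points Y \<longrightarrow>
        (\<exists>\<psi>. G_map G X Z \<psi> \<and> (\<forall>x\<in>points X. \<pi> (\<psi> x) = \<phi> x)))"


section \<open>The Samuel compactification\<close>

text \<open>Functions on \<open>S\<close> are represented as elements of \<open>extensional S\<close>, so that two of them are
  equal iff they agree on \<open>S\<close>.  For an algebra \<open>A\<close> of such functions (with pointwise operations),
  a character is an element of \<open>extensional A\<close>, and the Gelfand topology is the topology of
  pointwise convergence on \<open>A\<close>.\<close>

definition characters :: "'s set \<Rightarrow> ('s \<Rightarrow> complex) set \<Rightarrow> (('s \<Rightarrow> complex) \<Rightarrow> complex) set" where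
  "characters S A =
     {\<xi> \<in> extensional A.
        (\<exists>f\<in>A. \<xi> f \<noteq> 0) \<and>
        (\<forall>f\<in>A. \<forall>h\<in>A. \<xi> (\<lambda>s\<in>S. f s + h s) = \<xi> f + \<xi> h) \<and>
        (\<forall>c. \<forall>f\<in>A. \<xi> (\<lambda>s\<in>S. c * f s) = c * \<xi> f) \<and>
        (\<forall>f\<in>A. \<forall>h\<in>A. \<xi> (\<lambda>s\<in>S. f s * h s) = \<xi> f * \<xi> h)}"

definition gelfand_spectrum ::
  "'s set \<Rightarrow> ('s \<Rightarrow> complex) set \<Rightarrow> (('s \<Rightarrow> complex) \<Rightarrow> complex) topology" where
  "gelfand_spectrum S A = subtopology (product_topology (\<lambda>_. euclidean) A) (characters S A)"

definition sa_algebra :: "('g, 'm) topgroup_scheme \<Rightarrow> ('g \<Rightarrow> complex) set" where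
  "sa_algebra G =
     {f \<in> extensional (carrier G).
        bounded (f ` carrier G) \<and>
        (\<forall>\<epsilon>>0. \<exists>U. openin (grp_top G) U \<and> \<one>\<^bsub>G\<^esub> \<in> U \<and>
           (\<forall>u\<in>U. \<forall>g\<in>carrier G. cmod (f (u \<otimes>\<^bsub>G\<^esub> g) - f g) < \<epsilon>))}"

type_synonym 'g sa_point = "('g \<Rightarrow> complex) \<Rightarrow> complex"

text \<open>The action on \<open>Sa G\<close> is the one extending left multiplication on \<open>G\<close>, where \<open>g\<close> is identified
  with the character \<open>f \<mapsto> f g\<close>.\<close>

definition Sa :: "('g, 'm) topgroup_scheme \<Rightarrow> ('g, 'g sa_point) flow" where
  "Sa G = \<lparr> flow_top = gelfand_spectrum (carrier G) (sa_algebra G),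
            flow_act = (\<lambda>g \<xi>. \<lambda>f\<in>sa_algebra G. \<xi> (\<lambda>h\<in>carrier G. f (g \<otimes>\<^bsub>G\<^esub> h))) \<rparr>"

definition sa_embed :: "('g, 'm) topgroup_scheme \<Rightarrow> 'g \<Rightarrow> 'g sa_point" where
  "sa_embed G g = (\<lambda>f\<in>sa_algebra G. f g)"

text \<open>\<open>sa_orbit_map G X x\<close> is the map \<open>p \<mapsto> p x\<close>: the unique \<open>G\<close>-map \<open>Sa G \<rightarrow> X\<close> with \<open>g \<mapsto> g x\<close>.
  Extensionality only makes it unique as a HOL function.\<close>

definition sa_orbit_map ::
  "('g, 'm) topgroup_scheme \<Rightarrow> ('g, 'x) flow \<Rightarrow> 'x \<Rightarrow> 'g sa_point \<Rightarrow> 'x" where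
  "sa_orbit_map G X x =
     (THE \<phi>. \<phi> \<in> extensional (points (Sa G)) \<and> G_map G (Sa G) X \<phi> \<and>
             (\<forall>g\<in>carrier G. \<phi> (sa_embed G g) = flow_act X g x))"

definition sa_mult ::
  "('g, 'm) topgroup_scheme \<Rightarrow> 'g sa_point \<Rightarrow> 'g sa_point \<Rightarrow> 'g sa_point" where
  "sa_mult G p q = sa_orbit_map G (Sa G) q p"

definition sa_idempotent :: "('g, 'm) topgroup_scheme \<Rightarrow> 'g sa_point \<Rightarrow> bool" where
  "sa_idempotent G \<rho> \<longleftrightarrow> \<rho> \<in> points (Sa G) \<and> sa_mult G \<rho> \<rho> = \<rho>"

definition sa_left_ideal ::
  "('g, 'm) topgroup_scheme \<Rightarrow> 'g sa_point \<Rightarrow> ('g, 'g sa_point) flow" where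
  "sa_left_ideal G \<rho> =
     \<lparr> flow_top = subtopology (flow_top (Sa G)) ((\<lambda>p. sa_mult G p \<rho>) ` points (Sa G)),
       flow_act = flow_act (Sa G) \<rparr>"

end

theory Submission
  imports Defs
begin

text \<open>
  The two halves of the correspondence are both consequences of the fact that \<open>Sa G\<close> is the free
  flow on one generator, namely the image \<open>1\<close> of the neutral element: \<open>G\<close>-maps \<open>Sa G \<rightarrow> X\<close>
  correspond to points \<open>x\<close> of \<open>X\<close> (\<open>G_map_orbit_map\<close>, \<open>G_map_eq_orbit_map\<close>), and hence every
  \<open>G\<close>-map \<open>\<theta>\<close> satisfies \<open>\<theta> (p x) = p (\<theta> x)\<close> (\<open>G_map_commutes_with_orbit_map\<close>).

  If \<open>\<rho>\<close> is idempotent, then \<open>p \<rho> = p\<close> for all \<open>p\<close> in the left ideal \<open>Sa G \<cdot> \<rho>\<close>, so this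
  ideal is a retract of the free flow. A map \<open>\<phi>\<close> from it into \<open>Y\<close> is therefore lifted along
  \<open>\<pi> : Z \<rightarrow> Y\<close> by choosing \<open>z\<close> with \<open>\<pi> z = \<phi> \<rho>\<close> and sending \<open>p\<close> to \<open>p z\<close>. Conversely, if \<open>x\<close> has
  a dense orbit in \<open>X\<close>, then \<open>p \<mapsto> p x\<close> is onto, and projectivity gives a section \<open>\<psi>\<close> of it.
  Its value \<open>\<rho> = \<psi> x\<close> is idempotent because \<open>\<rho> \<rho> = \<psi> (\<rho> x) = \<psi> x\<close>, and the image of \<open>\<psi>\<close> is
  \<open>Sa G \<cdot> \<rho>\<close> because \<open>\<psi> (p x) = p \<rho>\<close>. The test flow needed here is \<open>Sa G\<close> over \<open>X\<close>, and \<open>X\<close> is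
  a quotient of \<open>Sa G\<close>; so both have copies in any type that is large enough to hold the points
  of \<open>Sa G\<close> (\<open>flow_copy_in_type\<close>).

  Most of the work is the universal property itself. Its core is \<open>character_approx\<close>: on finitely
  many functions a character is approximated by evaluation at a single group element. This rests
  on the algebra being closed under conjugation and under inverses of functions bounded away
  from zero, and it yields compactness of \<open>Sa G\<close>, density of \<open>G\<close> and joint continuity of the
  action. The map \<open>p \<mapsto> p x\<close> then has the closure of \<open>{(g, g x)}\<close> in \<open>Sa G \<times> X\<close> as its graph.
\<close>

section \<open>Continuous maps\<close>

lemma continuous_map_euclidean_epsI:
  fixes \<phi> :: "'a \<Rightarrow> 'b::metric_space"
  assumes "\<And>x \<epsilon>. x \<in> topspace X \<Longrightarrow> \<epsilon> > 0 \<Longrightarrow>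
             \<exists>W. openin X W \<and> x \<in> W \<and> (\<forall>y\<in>W. dist (\<phi> y) (\<phi> x) < \<epsilon>)"
  shows "continuous_map X euclidean \<phi>"
  unfolding continuous_map_def
proof (intro conjI allI impI)
  fix V :: "'b set"
  assume "openin euclidean V"
  then have V: "open V"
    by simp
  show "openin X {x \<in> topspace X. \<phi> x \<in> V}"
  proof (subst openin_subopen, intro ballI)
    fix x
    assume x: "x \<in> {x \<in> topspace X. \<phi> x \<in> V}"
    then obtain \<epsilon> where "\<epsilon> > 0" and \<epsilon>: "\<And>z. dist z (\<phi> x) < \<epsilon> \<Longrightarrow> z \<in> V"
      using V unfolding open_dist by blast
    then obtain W where W: "openin X W" "x \<in> W" "\<forall>y\<in>W. dist (\<phi> y) (\<phi> x) < \<epsilon>"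
      using assms[of x \<epsilon>] x by (simp, meson)
    then show "\<exists>T. openin X T \<and> x \<in> T \<and> T \<subseteq> {x \<in> topspace X. \<phi> x \<in> V}"
      using \<epsilon> subsetD[OF openin_subset[OF W(1)]] by (intro exI[of _ W] conjI subsetI) simp_all
  qed
qed auto

lemma completely_regular_space_complexD:
  assumes "completely_regular_space Y" "openin Y V" "y \<in> V"
  obtains F :: "'a \<Rightarrow> complex"
  where "continuous_map Y euclidean F" "F y = 0" "\<forall>z\<in>topspace Y - V. F z = 1"
proof -
  have "\<exists>f. continuous_map Y euclideanreal f \<and> f y = 0 \<and> f ` (topspace Y - V) \<subseteq> {1}"
    using assms unfolding completely_regular_space_alt' by simp
  then obtain f where f: "continuous_map Y euclideanreal f" "f y = 0"
      "f ` (topspace Y - V) \<subseteq> {1}"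
    by blast
  have "continuous_map euclideanreal euclidean complex_of_real"
    using continuous_on_of_real_id by (simp only: continuous_map_iff_continuous2)
  then have "continuous_map Y euclidean (complex_of_real \<circ> f)"
    using f(1) continuous_map_compose by metis
  moreover have "f z = 1" if "z \<in> topspace Y - V" for z
    using f(3) that by blast
  ultimately show ?thesis
    using f(2) that[of "complex_of_real \<circ> f"] by simp
qed

lemma eq_if_complex_functions_agree:
  assumes "completely_regular_space Y" "Hausdorff_space Y" "y \<in> topspace Y" "z \<in> topspace Y"
    and agree: "\<And>F :: 'a \<Rightarrow> complex. continuous_map Y euclidean F \<Longrightarrow> F y = F z"
  shows "y = z"
proof (rule ccontr)
  assume "y \<noteq> z"
  then obtain V where V: "openin Y V" "y \<in> V" "z \<notin> V"
    using assms(2-4) unfolding Hausdorff_space_def disjnt_iff by meson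
  obtain F :: "'a \<Rightarrow> complex" where F: "continuous_map Y euclidean F" "F y = 0"
      "\<forall>z\<in>topspace Y - V. F z = 1"
    using completely_regular_space_complexD[OF assms(1) V(1,2)] by blast
  have "F z = 1"
    using F(3) V(3) assms(4) by simp
  then show False
    using agree[OF F(1)] F(2) by simp
qed

text \<open>The topology of a completely regular space is induced by its continuous functions.\<close>

lemma continuous_map_into_completely_regular_space:
  assumes Y: "completely_regular_space Y" and \<phi>: "\<phi> \<in> topspace X \<rightarrow> topspace Y"
    and F\<phi>: "\<And>F :: 'b \<Rightarrow> complex. continuous_map Y euclidean F \<Longrightarrow>
               continuous_map X euclidean (\<lambda>x. F (\<phi> x))"
  shows "continuous_map X Y \<phi>"
  unfolding continuous_map_def
proof (intro conjI allI impI)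
  fix V
  assume V: "openin Y V"
  show "openin X {x \<in> topspace X. \<phi> x \<in> V}"
  proof (subst openin_subopen, intro ballI)
    fix x
    assume "x \<in> {x \<in> topspace X. \<phi> x \<in> V}"
    then have x: "x \<in> topspace X" "\<phi> x \<in> V"
      by auto
    obtain F :: "'b \<Rightarrow> complex" where F: "continuous_map Y euclidean F" "F (\<phi> x) = 0"
        "\<forall>z\<in>topspace Y - V. F z = 1"
      using completely_regular_space_complexD[OF Y V x(2)] by blast
    let ?W = "{z \<in> topspace X. F (\<phi> z) \<in> - {1}}"
    have "openin X ?W"
      by (rule openin_continuous_map_preimage[OF F\<phi>[OF F(1)]]) (simp add: open_Compl)
    moreover have "?W \<subseteq> {x \<in> topspace X. \<phi> x \<in> V}"
    proof (intro subsetI CollectI conjI)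
      fix z
      assume "z \<in> ?W"
      then have "F (\<phi> z) \<noteq> 1" "\<phi> z \<in> topspace Y"
        using \<phi> by auto
      then show "\<phi> z \<in> V"
        using F(3) by blast
    qed auto
    ultimately show "\<exists>T. openin X T \<and> x \<in> T \<and> T \<subseteq> {x \<in> topspace X. \<phi> x \<in> V}"
      using x F(2) by (intro exI[of _ ?W]) auto
  qed
qed (use \<phi> in auto)


section \<open>Flows and their maps\<close>

lemma G_flow_act_closed:
  assumes "G_flow G X" "topspace (grp_top G) = carrier G" "g \<in> carrier G" "x \<in> points X"
  shows "flow_act X g x \<in> points X"
proof -
  have "continuous_map (prod_topology (grp_top G) (flow_top X)) (flow_top X)
          (\<lambda>(g, x). flow_act X g x)"
    using assms(1) unfolding G_flow_def by blast
  from funcset_mem[OF continuous_map_funspace[OF this], of "(g, x)"] show ?thesis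
    using assms(2-4) by simp
qed

lemma G_map_closed: "G_map G X Y \<phi> \<Longrightarrow> x \<in> points X \<Longrightarrow> \<phi> x \<in> points Y"
  unfolding G_map_def using continuous_map_funspace[of "flow_top X" "flow_top Y" \<phi>] by auto

lemma G_map_act:
  "G_map G X Y \<phi> \<Longrightarrow> g \<in> carrier G \<Longrightarrow> x \<in> points X \<Longrightarrow>
     \<phi> (flow_act X g x) = flow_act Y g (\<phi> x)"
  unfolding G_map_def by simp

lemma G_map_compose:
  assumes \<phi>: "G_map G X Y \<phi>" and \<psi>: "G_map G Y Z \<psi>"
  shows "G_map G X Z (\<psi> \<circ> \<phi>)"
proof -
  have "continuous_map (flow_top X) (flow_top Z) (\<psi> \<circ> \<phi>)"
    using \<phi> \<psi> continuous_map_compose unfolding G_map_def by metis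
  then show ?thesis
    using G_map_act[OF \<phi>] G_map_act[OF \<psi>] G_map_closed[OF \<phi>]
    unfolding G_map_def by simp
qed

lemma flow_isomorphic_sym: "flow_isomorphic G X Y \<Longrightarrow> flow_isomorphic G Y X"
  unfolding flow_isomorphic_def by blast

lemma flow_isomorphic_imp_surj:
  assumes "flow_isomorphic G X Y"
  obtains \<phi> where "G_map G X Y \<phi>" "\<phi> ` points X = points Y"
proof -
  obtain \<phi> \<psi> where \<phi>: "G_map G X Y \<phi>" and \<psi>: "G_map G Y X \<psi>"
      and inv: "\<forall>y\<in>points Y. \<phi> (\<psi> y) = y"
    using assms unfolding flow_isomorphic_def by blast
  have "\<phi> ` points X = points Y"
    using G_map_closed[OF \<phi>] G_map_closed[OF \<psi>] inv by (metis image_eqI image_subsetI subsetI subset_antisym)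
  with \<phi> show ?thesis
    by (rule that)
qed

lemma point_transitive_image:
  assumes \<phi>: "G_map G X Y \<phi>" and surj: "\<phi> ` points X = points Y"
    and X: "point_transitive G X"
  shows "point_transitive G Y"
proof -
  obtain x where x: "x \<in> points X"
      "flow_top X closure_of ((\<lambda>g. flow_act X g x) ` carrier G) = points X"
    using X unfolding point_transitive_def by blast
  have "points Y = \<phi> ` (flow_top X closure_of ((\<lambda>g. flow_act X g x) ` carrier G))"
    using x surj by simp
  also have "\<dots> \<subseteq> flow_top Y closure_of (\<phi> ` (\<lambda>g. flow_act X g x) ` carrier G)"
    using \<phi> unfolding G_map_def by (intro continuous_map_image_closure_subset) simp
  also have "\<phi> ` (\<lambda>g. flow_act X g x) ` carrier G = (\<lambda>g. flow_act Y g (\<phi> x)) ` carrier G"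
    using G_map_act[OF \<phi> _ x(1)] unfolding image_image by (intro image_cong) simp_all
  finally show ?thesis
    unfolding point_transitive_def
    using G_map_closed[OF \<phi> x(1)] closure_of_subset_topspace[of "flow_top Y"]
    by (intro bexI[of _ "\<phi> x"] subset_antisym) simp_all
qed

lemma G_projective_isomorphic:
  fixes X :: "('g, 'x) flow" and Y :: "('g, 'y) flow" and U :: "'u itself"
  assumes iso: "flow_isomorphic G X Y" and X: "G_projective U G X"
  shows "G_projective U G Y"
proof -
  obtain \<alpha> \<beta> where \<alpha>: "G_map G X Y \<alpha>" and \<beta>: "G_map G Y X \<beta>"
    and \<alpha>\<beta>: "\<And>y. y \<in> points Y \<Longrightarrow> \<alpha> (\<beta> y) = y"
    using iso unfolding flow_isomorphic_def by blast
  show ?thesis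
    unfolding G_projective_def
  proof (intro allI impI, elim conjE)
    fix W Z :: "('g, 'u) flow" and \<phi> \<pi>
    assume WZ: "G_flow G W" "G_flow G Z" "G_map G Y W \<phi>" "G_map G Z W \<pi>"
      "\<pi> ` points Z = points W"
    then obtain \<psi> where \<psi>: "G_map G X Z \<psi>" "\<forall>x\<in>points X. \<pi> (\<psi> x) = (\<phi> \<circ> \<alpha>) x"
      using X G_map_compose[OF \<alpha> WZ(3)] unfolding G_projective_def by blast
    then have "\<forall>y\<in>points Y. \<pi> ((\<psi> \<circ> \<beta>) y) = \<phi> y"
      using G_map_closed[OF \<beta>] \<alpha>\<beta> by simp
    then show "\<exists>\<psi>. G_map G Y Z \<psi> \<and> (\<forall>y\<in>points Y. \<pi> (\<psi> y) = \<phi> y)"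
      using G_map_compose[OF \<beta> \<psi>(1)] by blast
  qed
qed

text \<open>The topology and the action are transported along an injection of the points. This is what
  lets a sufficiently large type stand for all flows of bounded size.\<close>

lemma flow_copy_in_type:
  fixes X :: "('g, 'x) flow"
  assumes X: "G_flow G X" and G: "topspace (grp_top G) = carrier G"
    and large: "points X \<lesssim> (UNIV :: 'u set)"
  obtains X' :: "('g, 'u) flow" where "G_flow G X'" "flow_isomorphic G X X'"
proof -
  obtain j :: "'x \<Rightarrow> 'u" where j: "inj_on j (points X)"
    using large unfolding lepoll_def by blast
  define k where "k = inv_into (points X) j"
  define T where "T = pullback_topology (j ` points X) k (flow_top X)"
  define X' where "X' = \<lparr>flow_top = T, flow_act = (\<lambda>g u. j (flow_act X g (k u)))\<rparr>"
  have kj: "k (j x) = x" if "x \<in> points X" for x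
    using j that by (simp add: k_def)
  have T: "topspace T = j ` points X"
    using kj by (auto simp: T_def topspace_pullback_topology)
  have cj: "continuous_map (flow_top X) T j"
    unfolding T_def
  proof (rule continuous_map_pullback')
    show "continuous_map (flow_top X) (flow_top X) (k \<circ> j)"
      by (rule continuous_map_eq[OF continuous_map_id]) (simp add: kj)
  qed auto
  have ck: "continuous_map T (flow_top X) k"
    unfolding T_def
    using continuous_map_pullback[OF continuous_map_id[of "flow_top X"], of "j ` points X" k]
    by simp
  have hom: "homeomorphic_maps (flow_top X) T j k"
    using cj ck kj T by (auto simp: homeomorphic_maps_def)
  then have "flow_top X homeomorphic_space T"
    unfolding homeomorphic_space_def by blast
  then have "compact_space T" "Hausdorff_space T"
    using X homeomorphic_compact_space homeomorphic_Hausdorff_space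
    unfolding G_flow_def by blast+
  moreover have "continuous_map (prod_topology (grp_top G) T) T (\<lambda>(g, u). j (flow_act X g (k u)))"
  proof -
    have "continuous_map (prod_topology (grp_top G) T) (prod_topology (grp_top G) (flow_top X))
            (\<lambda>p. (fst p, k (snd p)))"
      by (intro continuous_map_pairedI continuous_map_fst
           continuous_map_compose[OF continuous_map_snd ck, unfolded comp_def])
    moreover have "continuous_map (prod_topology (grp_top G) (flow_top X)) (flow_top X)
        (\<lambda>(g, x). flow_act X g x)"
      using X unfolding G_flow_def by blast
    ultimately have "continuous_map (prod_topology (grp_top G) T) T
        (j \<circ> ((\<lambda>(g, x). flow_act X g x) \<circ> (\<lambda>p. (fst p, k (snd p)))))"
      by (intro continuous_map_compose[OF _ cj] continuous_map_compose)
    then show ?thesis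
      by (simp add: comp_def case_prod_unfold)
  qed
  ultimately have "G_flow G X'"
    using X G_flow_act_closed[OF X G] kj
    unfolding G_flow_def X'_def flow.simps T ball_simps by simp
  moreover have "G_map G X X' j"
    using cj kj by (simp add: G_map_def X'_def)
  moreover have "G_map G X' X k"
    using ck kj G_flow_act_closed[OF X G] by (simp add: G_map_def X'_def T)
  ultimately have "G_flow G X' \<and> flow_isomorphic G X X'"
    unfolding flow_isomorphic_def using T kj
    by (auto intro!: exI[of _ j] exI[of _ k] simp: X'_def)
  then show ?thesis
    using that by blast
qed

text \<open>Lifting against flows over arbitrary types: the square is moved into the universe type, solved
  there, and the solution is moved back.\<close>

lemma G_projective_lift:
  fixes X :: "('g, 'x) flow" and Y :: "('g, 'y) flow" and Z :: "('g, 'z) flow"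
  assumes X: "G_projective TYPE('u) G X" and G: "topspace (grp_top G) = carrier G"
    and Y: "G_flow G Y" "points Y \<lesssim> (UNIV :: 'u set)"
    and Z: "G_flow G Z" "points Z \<lesssim> (UNIV :: 'u set)"
    and \<phi>: "G_map G X Y \<phi>" and \<pi>: "G_map G Z Y \<pi>" "\<pi> ` points Z = points Y"
  obtains \<psi> where "G_map G X Z \<psi>" "\<And>x. x \<in> points X \<Longrightarrow> \<pi> (\<psi> x) = \<phi> x"
proof -
  obtain Y' :: "('g, 'u) flow" where Y': "G_flow G Y'" "flow_isomorphic G Y Y'"
    using flow_copy_in_type[OF Y(1) G Y(2)] by blast
  obtain Z' :: "('g, 'u) flow" where Z': "G_flow G Z'" "flow_isomorphic G Z Z'"
    using flow_copy_in_type[OF Z(1) G Z(2)] by blast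
  obtain a a' where a: "G_map G Y Y' a" "G_map G Y' Y a'"
      "\<And>y. y \<in> points Y \<Longrightarrow> a' (a y) = y" "\<And>y. y \<in> points Y' \<Longrightarrow> a (a' y) = y"
    using Y'(2) unfolding flow_isomorphic_def by blast
  obtain b b' where b: "G_map G Z Z' b" "G_map G Z' Z b'"
      "\<And>z. z \<in> points Z \<Longrightarrow> b' (b z) = z" "\<And>z. z \<in> points Z' \<Longrightarrow> b (b' z) = z"
    using Z'(2) unfolding flow_isomorphic_def by blast
  let ?\<pi> = "a \<circ> \<pi> \<circ> b'"
  have "?\<pi> ` points Z' = points Y'"
  proof
    show "?\<pi> ` points Z' \<subseteq> points Y'"
      using G_map_closed[OF b(2)] G_map_closed[OF \<pi>(1)] G_map_closed[OF a(1)] by auto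
    show "points Y' \<subseteq> ?\<pi> ` points Z'"
    proof
      fix y
      assume y: "y \<in> points Y'"
      then obtain z where z: "z \<in> points Z" "\<pi> z = a' y"
        using G_map_closed[OF a(2)] \<pi>(2) by (metis imageE)
      then show "y \<in> ?\<pi> ` points Z'"
        using y a(4) b(3) G_map_closed[OF b(1)] by (intro image_eqI[of _ _ "b z"]) auto
    qed
  qed
  moreover have "G_map G Z' Y' ?\<pi>"
    by (intro G_map_compose[OF b(2)] G_map_compose[OF \<pi>(1) a(1)])
  ultimately obtain \<psi> where \<psi>: "G_map G X Z' \<psi>" "\<forall>x\<in>points X. ?\<pi> (\<psi> x) = (a \<circ> \<phi>) x"
    using X Y'(1) Z'(1) G_map_compose[OF \<phi> a(1)] unfolding G_projective_def by blast
  show ?thesis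
  proof (rule that)
    show "G_map G X Z (b' \<circ> \<psi>)"
      using G_map_compose[OF \<psi>(1) b(2)] .
  next
    fix x
    assume x: "x \<in> points X"
    have "a (\<pi> (b' (\<psi> x))) = a (\<phi> x)"
      using \<psi>(2) x by simp
    moreover have "\<pi> (b' (\<psi> x)) \<in> points Y" "\<phi> x \<in> points Y"
      using x G_map_closed[OF \<psi>(1)] G_map_closed[OF b(2)] G_map_closed[OF \<pi>(1)]
        G_map_closed[OF \<phi>] by blast+
    ultimately show "\<pi> ((b' \<circ> \<psi>) x) = \<phi> x"
      using a(3) by (metis comp_apply)
  qed
qed


section \<open>The algebra of uniformly continuous functions\<close>

locale top_group =
  fixes G :: "('g, 'm) topgroup_scheme" (structure)
  assumes topological_group: "topological_group G"
begin

sublocale group G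
  using topological_group unfolding topological_group_def by blast

lemma topspace_grp [simp]: "topspace (grp_top G) = carrier G"
  using topological_group unfolding topological_group_def by blast

lemma continuous_mult:
  "continuous_map (prod_topology (grp_top G) (grp_top G)) (grp_top G) (\<lambda>(g, h). g \<otimes> h)"
  using topological_group unfolding topological_group_def by blast

lemma openin_grp_subset: "openin (grp_top G) U \<Longrightarrow> u \<in> U \<Longrightarrow> u \<in> carrier G"
  using openin_subset by fastforce

abbreviation A :: "('g \<Rightarrow> complex) set" where
  "A \<equiv> sa_algebra G"

abbreviation const_fun :: "complex \<Rightarrow> 'g \<Rightarrow> complex" where
  "const_fun c \<equiv> \<lambda>g\<in>carrier G. c"

abbreviation left_translate :: "'g \<Rightarrow> ('g \<Rightarrow> complex) \<Rightarrow> 'g \<Rightarrow> complex" where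
  "left_translate g f \<equiv> \<lambda>h\<in>carrier G. f (g \<otimes> h)"

lemma sa_algebra_ext:
  assumes "f \<in> A" "h \<in> extensional (carrier G)" "\<And>g. g \<in> carrier G \<Longrightarrow> f g = h g"
  shows "f = h"
  using assms unfolding sa_algebra_def by (blast intro: extensionalityI)

lemma sa_algebra_bounded: "f \<in> A \<Longrightarrow> bounded (f ` carrier G)"
  unfolding sa_algebra_def by blast

lemma sa_algebra_uniform:
  assumes "f \<in> A" "\<epsilon> > 0"
  obtains U where "openin (grp_top G) U" "\<one> \<in> U"
    "\<forall>u\<in>U. \<forall>g\<in>carrier G. cmod (f (u \<otimes> g) - f g) < \<epsilon>"
  using assms unfolding sa_algebra_def by blast

lemma sa_algebraI:
  assumes "f \<in> extensional (carrier G)" "bounded (f ` carrier G)"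
    "\<And>\<epsilon>. \<epsilon> > 0 \<Longrightarrow> \<exists>U. openin (grp_top G) U \<and> \<one> \<in> U \<and>
       (\<forall>u\<in>U. \<forall>g\<in>carrier G. cmod (f (u \<otimes> g) - f g) < \<epsilon>)"
  shows "f \<in> A"
  using assms unfolding sa_algebra_def by blast

text \<open>The functions in the algebra are bounded, so the pair \<open>(f, h)\<close> takes values in a compact subset
  of \<open>K\<close>, where \<open>F\<close> is uniformly continuous. The binary form with a closed set \<open>K\<close> covers sums,
  products, conjugates and inverses at once.\<close>

lemma sa_algebra_compose:
  assumes f: "f \<in> A" and h: "h \<in> A" and K: "closed K" and F: "continuous_on K F"
    and fh: "\<And>g. g \<in> carrier G \<Longrightarrow> (f g, h g) \<in> K"
  shows "(\<lambda>g\<in>carrier G. F (f g, h g)) \<in> A"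
proof (rule sa_algebraI)
  define L where "L = closure ((\<lambda>g. (f g, h g)) ` carrier G)"
  have "bounded (f ` carrier G \<times> h ` carrier G)"
    using f h by (intro bounded_Times sa_algebra_bounded)
  then have "bounded ((\<lambda>g. (f g, h g)) ` carrier G)"
    by (rule bounded_subset) auto
  then have L: "compact L"
    by (simp add: L_def)
  have "L \<subseteq> K"
    unfolding L_def using K fh by (intro closure_minimal) auto
  then have FL: "continuous_on L F"
    using F continuous_on_subset by blast
  have inL: "(f g, h g) \<in> L" if "g \<in> carrier G" for g
    using that unfolding L_def by (intro subsetD[OF closure_subset] imageI)
  have "bounded (F ` L)"
    using FL L by (intro compact_imp_bounded compact_continuous_image)
  then show "bounded ((\<lambda>g\<in>carrier G. F (f g, h g)) ` carrier G)"
    by (rule bounded_subset) (use inL in auto)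
  fix \<epsilon> :: real
  assume "\<epsilon> > 0"
  then obtain \<delta> where "\<delta> > 0"
    and \<delta>: "\<forall>p\<in>L. \<forall>q\<in>L. dist q p < \<delta> \<longrightarrow> dist (F q) (F p) < \<epsilon>"
    using compact_uniformly_continuous[OF FL L] unfolding uniformly_continuous_on_def by blast
  then have d2: "\<delta> / 2 > 0"
    by simp
  obtain U where U: "openin (grp_top G) U" "\<one> \<in> U"
      "\<forall>u\<in>U. \<forall>g\<in>carrier G. cmod (f (u \<otimes> g) - f g) < \<delta> / 2"
    by (rule sa_algebra_uniform[OF f d2])
  obtain V where V: "openin (grp_top G) V" "\<one> \<in> V"
      "\<forall>u\<in>V. \<forall>g\<in>carrier G. cmod (h (u \<otimes> g) - h g) < \<delta> / 2"
    by (rule sa_algebra_uniform[OF h d2])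
  have "cmod (F (f (u \<otimes> g), h (u \<otimes> g)) - F (f g, h g)) < \<epsilon>"
    if u: "u \<in> U \<inter> V" and g: "g \<in> carrier G" for u g
  proof -
    have ug: "u \<otimes> g \<in> carrier G"
      using u g openin_grp_subset[OF U(1)] by simp
    have "dist (f (u \<otimes> g), h (u \<otimes> g)) (f g, h g)
            \<le> dist (f (u \<otimes> g)) (f g) + dist (h (u \<otimes> g)) (h g)"
      unfolding dist_Pair_Pair by (rule sqrt_sum_squares_le_sum) simp_all
    also have "\<dots> < \<delta> / 2 + \<delta> / 2"
      using U(3) V(3) u g unfolding dist_norm by (intro add_strict_mono) blast+
    finally have "dist (F (f (u \<otimes> g), h (u \<otimes> g))) (F (f g, h g)) < \<epsilon>"
      using \<delta> inL[OF g] inL[OF ug] by simp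
    then show ?thesis
      by (simp add: dist_norm)
  qed
  then show "\<exists>U. openin (grp_top G) U \<and> \<one> \<in> U \<and> (\<forall>u\<in>U. \<forall>g\<in>carrier G.
      cmod ((\<lambda>g\<in>carrier G. F (f g, h g)) (u \<otimes> g) - (\<lambda>g\<in>carrier G. F (f g, h g)) g) < \<epsilon>)"
    using U(1,2) V(1,2) openin_grp_subset[OF U(1)]
    by (intro exI[of _ "U \<inter> V"]) (simp add: openin_Int)
qed simp

lemma sa_algebra_const: "const_fun c \<in> A"
proof (rule sa_algebraI)
  show "bounded (const_fun c ` carrier G)"
    by (rule bounded_subset[of "{c}"]) auto
next
  fix \<epsilon> :: real
  assume "\<epsilon> > 0"
  then show "\<exists>U. openin (grp_top G) U \<and> \<one> \<in> U \<and>
      (\<forall>u\<in>U. \<forall>g\<in>carrier G. cmod (const_fun c (u \<otimes> g) - const_fun c g) < \<epsilon>)"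
    using openin_topspace[of "grp_top G"] by (intro exI[of _ "carrier G"]) simp
qed simp

lemma sa_algebra_add: "f \<in> A \<Longrightarrow> h \<in> A \<Longrightarrow> (\<lambda>g\<in>carrier G. f g + h g) \<in> A"
  using sa_algebra_compose[of f h UNIV "\<lambda>p. fst p + snd p"]
  by (simp add: continuous_on_add continuous_on_fst continuous_on_snd)

lemma sa_algebra_mult: "f \<in> A \<Longrightarrow> h \<in> A \<Longrightarrow> (\<lambda>g\<in>carrier G. f g * h g) \<in> A"
  using sa_algebra_compose[of f h UNIV "\<lambda>p. fst p * snd p"]
  by (simp add: continuous_on_mult continuous_on_fst continuous_on_snd)

lemma sa_algebra_scale: "f \<in> A \<Longrightarrow> (\<lambda>g\<in>carrier G. c * f g) \<in> A"
  using sa_algebra_compose[of f f UNIV "\<lambda>p. c * fst p"]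
  by (simp add: continuous_on_mult continuous_on_fst)

lemma sa_algebra_cnj: "f \<in> A \<Longrightarrow> (\<lambda>g\<in>carrier G. cnj (f g)) \<in> A"
  using sa_algebra_compose[of f f UNIV "\<lambda>p. cnj (fst p)"]
  by (simp add: continuous_on_cnj continuous_on_fst)

lemma sa_algebra_inverse:
  assumes f: "f \<in> A" and \<delta>: "\<delta> > 0" "\<And>g. g \<in> carrier G \<Longrightarrow> \<delta> \<le> cmod (f g)"
  shows "(\<lambda>g\<in>carrier G. inverse (f g)) \<in> A"
proof -
  let ?K = "{p :: complex \<times> complex. \<delta> \<le> cmod (fst p)}"
  have "closed ?K"
    by (intro closed_Collect_le continuous_intros)
  moreover have "continuous_on ?K (\<lambda>p. inverse (fst p))"
    by (intro continuous_intros) (use \<delta>(1) in auto)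
  ultimately show ?thesis
    using sa_algebra_compose[OF f f, of ?K "\<lambda>p. inverse (fst p)"] \<delta>(2) by simp
qed

text \<open>The uniformity condition concerns perturbations \<open>u g\<close> on the left, so a left translate by \<open>g\<close>
  satisfies it with the neighbourhoods conjugated by \<open>g\<close>.\<close>

lemma left_translate_sa_algebra:
  assumes f: "f \<in> A" and g: "g \<in> carrier G"
  shows "left_translate g f \<in> A"
proof (rule sa_algebraI)
  show "bounded (left_translate g f ` carrier G)"
    by (rule bounded_subset[OF sa_algebra_bounded[OF f]]) (use g in auto)
next
  fix \<epsilon> :: real
  assume "\<epsilon> > 0"
  then obtain U where U: "openin (grp_top G) U" "\<one> \<in> U"
      "\<forall>u\<in>U. \<forall>h\<in>carrier G. cmod (f (u \<otimes> h) - f h) < \<epsilon>"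
    by (rule sa_algebra_uniform[OF f])
  let ?V = "{v \<in> carrier G. g \<otimes> v \<otimes> inv g \<in> U}"
  have "continuous_map (grp_top G) (grp_top G)
          ((\<lambda>(g, h). g \<otimes> h) \<circ> (\<lambda>v. (((\<lambda>(g, h). g \<otimes> h) \<circ> (\<lambda>v. (g, v))) v, inv g)))"
    using g by (intro continuous_map_compose[OF _ continuous_mult] continuous_map_pairedI
        continuous_map_id[unfolded id_def]) simp_all
  then have "continuous_map (grp_top G) (grp_top G) (\<lambda>v. g \<otimes> v \<otimes> inv g)"
    by (simp add: comp_def)
  then have "openin (grp_top G) ?V"
    using openin_continuous_map_preimage[OF _ U(1)] by fastforce
  moreover have "\<one> \<in> ?V"
    using g U(2) by simp
  moreover have "cmod (left_translate g f (v \<otimes> h) - left_translate g f h) < \<epsilon>"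
    if v: "v \<in> ?V" and h: "h \<in> carrier G" for v h
  proof -
    have "g \<otimes> (v \<otimes> h) = (g \<otimes> v \<otimes> inv g) \<otimes> (g \<otimes> h)"
      using g v h by (simp add: m_assoc inv_solve_left)
    then show ?thesis
      using U(3) v g h by simp
  qed
  ultimately show "\<exists>U. openin (grp_top G) U \<and> \<one> \<in> U \<and> (\<forall>u\<in>U. \<forall>h\<in>carrier G.
      cmod (left_translate g f (u \<otimes> h) - left_translate g f h) < \<epsilon>)"
    by blast
qed simp


section \<open>Characters are limits of evaluations\<close>

lemma points_Sa: "points (Sa G) = characters (carrier G) A"
  unfolding Sa_def gelfand_spectrum_def characters_def by (auto simp: PiE_def)

lemma character_ext:
  "\<xi> \<in> points (Sa G) \<Longrightarrow> \<eta> \<in> points (Sa G) \<Longrightarrow> (\<And>f. f \<in> A \<Longrightarrow> \<xi> f = \<eta> f) \<Longrightarrow> \<xi> = \<eta>"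
  unfolding points_Sa characters_def by (blast intro: extensionalityI)

context
  fixes \<xi>
  assumes \<xi>: "\<xi> \<in> points (Sa G)"
begin

lemma character_add: "f \<in> A \<Longrightarrow> h \<in> A \<Longrightarrow> \<xi> (\<lambda>g\<in>carrier G. f g + h g) = \<xi> f + \<xi> h"
  using \<xi> unfolding points_Sa characters_def by blast

lemma character_scale: "f \<in> A \<Longrightarrow> \<xi> (\<lambda>g\<in>carrier G. c * f g) = c * \<xi> f"
  using \<xi> unfolding points_Sa characters_def by blast

lemma character_mult: "f \<in> A \<Longrightarrow> h \<in> A \<Longrightarrow> \<xi> (\<lambda>g\<in>carrier G. f g * h g) = \<xi> f * \<xi> h"
  using \<xi> unfolding points_Sa characters_def by blast

lemma character_const: "\<xi> (const_fun c) = c"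
proof -
  obtain f where f: "f \<in> A" "\<xi> f \<noteq> 0"
    using \<xi> unfolding points_Sa characters_def by blast
  have "(\<lambda>g\<in>carrier G. c * f g) = (\<lambda>g\<in>carrier G. const_fun c g * f g)"
    by (rule restrict_ext) simp
  then have "c * \<xi> f = \<xi> (const_fun c) * \<xi> f"
    using character_scale[OF f(1), of c] character_mult[OF sa_algebra_const[of c] f(1)] by simp
  then show ?thesis
    using f(2) by simp
qed

text \<open>Each deviation \<open>f - \<xi> f\<close> lies in the kernel of \<open>\<xi>\<close>, which is an ideal; multiplying by the
  conjugate makes the deviations nonnegative, so that they cannot cancel in the sum.\<close>

lemma sum_of_squared_deviations_in_kernel:
  assumes "finite F" "F \<subseteq> A"
  shows "\<exists>q\<in>A. \<xi> q = 0 \<and>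
           (\<forall>g\<in>carrier G. q g = of_real (\<Sum>f\<in>F. (cmod (f g - \<xi> f))\<^sup>2))"
  using assms
proof (induction F rule: finite_induct)
  case empty
  show ?case
    by (rule bexI[OF _ sa_algebra_const[of 0]], rule conjI, rule character_const) simp
next
  case (insert f F)
  then obtain q where q: "q \<in> A" "\<xi> q = 0"
      "\<forall>g\<in>carrier G. q g = of_real (\<Sum>f\<in>F. (cmod (f g - \<xi> f))\<^sup>2)"
    by auto
  have f: "f \<in> A"
    using insert.prems by simp
  define d where "d = (\<lambda>g\<in>carrier G. f g + const_fun (- \<xi> f) g)"
  have d: "d \<in> A" "\<xi> d = 0"
    using sa_algebra_add[OF f sa_algebra_const] character_add[OF f sa_algebra_const]
      character_const by (simp_all add: d_def)
  define d' where "d' = (\<lambda>g\<in>carrier G. cnj (d g))"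
  have d': "d' \<in> A"
    unfolding d'_def by (rule sa_algebra_cnj[OF d(1)])
  define s where "s = (\<lambda>g\<in>carrier G. d g * d' g)"
  have s: "s \<in> A" "\<xi> s = 0"
    using sa_algebra_mult[OF d(1) d'] character_mult[OF d(1) d'] d(2) by (simp_all add: s_def)
  define t where "t = (\<lambda>g\<in>carrier G. s g + q g)"
  have "t g = of_real (\<Sum>f\<in>insert f F. (cmod (f g - \<xi> f))\<^sup>2)" if "g \<in> carrier G" for g
  proof -
    have "s g = of_real ((cmod (f g - \<xi> f))\<^sup>2)"
      unfolding complex_norm_square using that by (simp add: s_def d'_def d_def)
    then show ?thesis
      using that q(3) insert.hyps by (simp add: t_def)
  qed
  moreover have "t \<in> A" "\<xi> t = 0"
    using sa_algebra_add[OF s(1) q(1)] character_add[OF s(1) q(1)] s(2) q(2)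
    by (simp_all add: t_def)
  ultimately show ?case
    by (intro bexI[of _ t]) simp_all
qed

text \<open>Otherwise the sum of squared deviations is at least \<open>\<epsilon>\<^sup>2\<close> everywhere on the group, hence
  invertible in the algebra, although a character kills it.\<close>

lemma character_approx:
  assumes F: "finite F" "F \<subseteq> A" and \<epsilon>: "\<epsilon> > 0"
  obtains g where "g \<in> carrier G" "\<forall>f\<in>F. cmod (f g - \<xi> f) < \<epsilon>"
proof (rule ccontr)
  assume "\<not> thesis"
  then have far: "\<exists>f\<in>F. \<epsilon> \<le> cmod (f g - \<xi> f)" if "g \<in> carrier G" for g
    using that linorder_not_less \<open>\<And>g. \<lbrakk>g \<in> carrier G; \<forall>f\<in>F. cmod (f g - \<xi> f) < \<epsilon>\<rbrakk> \<Longrightarrow> thesis\<close>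
    by metis
  obtain q where q: "q \<in> A" "\<xi> q = 0"
      "\<forall>g\<in>carrier G. q g = of_real (\<Sum>f\<in>F. (cmod (f g - \<xi> f))\<^sup>2)"
    using sum_of_squared_deviations_in_kernel[OF F] by blast
  have q_ge: "\<epsilon>\<^sup>2 \<le> cmod (q g)" if g: "g \<in> carrier G" for g
  proof -
    obtain f where f: "f \<in> F" "\<epsilon> \<le> cmod (f g - \<xi> f)"
      using far[OF g] by blast
    have "\<epsilon>\<^sup>2 \<le> (cmod (f g - \<xi> f))\<^sup>2"
      using f(2) \<epsilon> by (intro power_mono) simp_all
    also have "\<dots> \<le> (\<Sum>f\<in>F. (cmod (f g - \<xi> f))\<^sup>2)"
      by (rule member_le_sum[OF f(1)]) (simp_all add: F(1))
    finally show ?thesis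
      using q(3) g by (simp add: sum_nonneg flip: of_real_power of_real_sum)
  qed
  have \<epsilon>2: "\<epsilon>\<^sup>2 > 0"
    using \<epsilon> by simp
  define r where "r = (\<lambda>g\<in>carrier G. inverse (q g))"
  have r: "r \<in> A"
    unfolding r_def by (rule sa_algebra_inverse[OF q(1) \<epsilon>2 q_ge])
  have "q g * r g = 1" if "g \<in> carrier G" for g
  proof -
    have "q g \<noteq> 0"
      using q_ge[OF that] \<epsilon>2 by auto
    then show ?thesis
      using that by (simp add: r_def)
  qed
  then have "(\<lambda>g\<in>carrier G. q g * r g) = const_fun 1"
    by (intro restrict_ext) simp
  then show False
    using character_mult[OF q(1) r] character_const[of 1] q(2) by simp
qed

end

lemma sa_embed_points:
  assumes "g \<in> carrier G"
  shows "sa_embed G g \<in> points (Sa G)"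
proof -
  have "\<exists>f\<in>A. sa_embed G g f \<noteq> 0"
    using sa_algebra_const[of 1] assms by (intro bexI[of _ "const_fun 1"]) (simp_all add: sa_embed_def)
  then show ?thesis
    using assms sa_algebra_add sa_algebra_mult sa_algebra_scale
    unfolding points_Sa characters_def by (simp add: sa_embed_def)
qed

text \<open>The bound holds for evaluations, and characters are limits of those.\<close>

lemma character_contraction:
  assumes \<xi>: "\<xi> \<in> points (Sa G)" and f: "f \<in> A" and h: "h \<in> A"
    and le: "\<And>g. g \<in> carrier G \<Longrightarrow> cmod (f g - h g) \<le> r"
  shows "cmod (\<xi> f - \<xi> h) \<le> r"
proof (rule field_le_epsilon)
  fix \<epsilon> :: real
  assume "\<epsilon> > 0"
  then have "\<epsilon> / 2 > 0"
    by simp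
  then obtain g where g: "g \<in> carrier G" "\<forall>k\<in>{f, h}. cmod (k g - \<xi> k) < \<epsilon> / 2"
    using character_approx[OF \<xi>, of "{f, h}" "\<epsilon> / 2"] f h by auto
  have "\<xi> f - \<xi> h = (f g - h g) - (f g - \<xi> f) + (h g - \<xi> h)"
    by simp
  also have "cmod \<dots> \<le> cmod (f g - h g) + cmod (f g - \<xi> f) + cmod (h g - \<xi> h)"
    by (meson add_right_mono norm_triangle_ineq norm_triangle_ineq4 order_trans)
  also have "\<dots> \<le> r + \<epsilon>"
    using le[OF g(1)] g(2) by simp
  finally show "cmod (\<xi> f - \<xi> h) \<le> r + \<epsilon>" .
qed


section \<open>The Samuel compactification is a flow\<close>

lemma flow_top_Sa:
  "flow_top (Sa G) = subtopology (product_topology (\<lambda>_. euclidean) A) (characters (carrier G) A)"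
  by (simp add: Sa_def gelfand_spectrum_def)

lemma flow_act_Sa: "f \<in> A \<Longrightarrow> flow_act (Sa G) g \<xi> f = \<xi> (left_translate g f)"
  by (simp add: Sa_def)

lemma continuous_eval:
  assumes "f \<in> A"
  shows "continuous_map (flow_top (Sa G)) euclidean (\<lambda>\<xi>. \<xi> f)"
  unfolding flow_top_Sa using assms
  by (intro continuous_map_from_subtopology continuous_map_product_projection)

lemma continuous_map_into_Sa:
  assumes "\<And>x. x \<in> topspace T \<Longrightarrow> \<phi> x \<in> points (Sa G)"
    and "\<And>f. f \<in> A \<Longrightarrow> continuous_map T euclidean (\<lambda>x. \<phi> x f)"
  shows "continuous_map T (flow_top (Sa G)) \<phi>"
proof -
  have "points (Sa G) \<subseteq> extensional A"
    unfolding points_Sa characters_def by blast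
  then show ?thesis
    using assms
    unfolding points_Sa unfolding flow_top_Sa continuous_map_in_subtopology continuous_map_componentwise
    by blast
qed

lemma Hausdorff_space_Sa: "Hausdorff_space (flow_top (Sa G))"
  unfolding flow_top_Sa
  by (intro Hausdorff_space_subtopology) (simp add: Hausdorff_space_product_topology)

text \<open>Being nonzero is not a closed condition, but for a multiplicative functional it can be replaced
  by the equation \<open>\<xi> 1 = 1\<close>.\<close>

lemma closedin_points_Sa: "closedin (product_topology (\<lambda>_. euclidean) A) (points (Sa G))"
proof -
  let ?P = "product_topology (\<lambda>_. euclidean) A :: ('g sa_point) topology"
  have eval: "continuous_map ?P euclidean (\<lambda>\<xi>. \<xi> f)" if "f \<in> A" for f
    using that by (rule continuous_map_product_projection)
  have closed: "closedin ?P {\<xi> \<in> topspace ?P. u \<xi> = v \<xi>}"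
    if "continuous_map ?P euclidean u" "continuous_map ?P euclidean v" for u v :: "'g sa_point \<Rightarrow> complex"
    using that by (intro closedin_continuous_maps_eq[of euclidean]) simp_all
  have mult: "continuous_map ?P euclidean (\<lambda>\<xi>. u \<xi> * v \<xi>)"
    if "continuous_map ?P euclidean u" "continuous_map ?P euclidean v" for u v :: "'g sa_point \<Rightarrow> complex"
    using that by (simp add: continuous_map_atin tendsto_mult)
  have "points (Sa G) =
      {\<xi> \<in> topspace ?P. \<xi> (const_fun 1) = 1} \<inter>
      (\<Inter>(f, h)\<in>A \<times> A. {\<xi> \<in> topspace ?P. \<xi> (\<lambda>g\<in>carrier G. f g + h g) = \<xi> f + \<xi> h}) \<inter>
      (\<Inter>(c, f)\<in>UNIV \<times> A. {\<xi> \<in> topspace ?P. \<xi> (\<lambda>g\<in>carrier G. c * f g) = c * \<xi> f}) \<inter>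
      (\<Inter>(f, h)\<in>A \<times> A. {\<xi> \<in> topspace ?P. \<xi> (\<lambda>g\<in>carrier G. f g * h g) = \<xi> f * \<xi> h})"
    (is "_ = ?R")
  proof (intro subset_antisym subsetI)
    fix \<xi>
    assume \<xi>: "\<xi> \<in> points (Sa G)"
    then have "\<xi> \<in> topspace ?P"
      by (simp add: points_Sa characters_def PiE_def)
    then show "\<xi> \<in> ?R"
      using character_const[OF \<xi>] character_add[OF \<xi>] character_scale[OF \<xi>] character_mult[OF \<xi>]
      by simp
  next
    fix \<xi>
    assume \<xi>: "\<xi> \<in> ?R"
    then have "\<xi> (const_fun 1) \<noteq> 0" "\<xi> \<in> extensional A"
      by (simp_all add: PiE_def)
    moreover from this have "\<exists>f\<in>A. \<xi> f \<noteq> 0"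
      using sa_algebra_const[of 1] by blast
    ultimately show "\<xi> \<in> points (Sa G)"
      using \<xi> unfolding points_Sa characters_def by simp
  qed
  also have "closedin ?P ?R"
    using sa_algebra_const[of 1]
    by (intro closedin_Int closedin_INT)
      (auto simp del: topspace_product_topology
        intro!: closed mult eval continuous_map_add sa_algebra_const sa_algebra_add
          sa_algebra_mult sa_algebra_scale)
  finally show ?thesis .
qed

text \<open>Contractivity places the characters in a product of closed discs, which is compact by
  Tychonoff.\<close>

lemma compact_space_Sa: "compact_space (flow_top (Sa G))"
proof -
  let ?P = "product_topology (\<lambda>_. euclidean) A :: ('g sa_point) topology"
  have "\<forall>f\<in>A. \<exists>b. \<forall>g\<in>carrier G. cmod (f g) \<le> b"
    using sa_algebra_bounded unfolding bounded_iff by blast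
  then obtain b where b: "\<And>f g. f \<in> A \<Longrightarrow> g \<in> carrier G \<Longrightarrow> cmod (f g) \<le> b f"
    by metis
  have "\<xi> f \<in> cball 0 (b f)" if \<xi>: "\<xi> \<in> points (Sa G)" and f: "f \<in> A" for \<xi> f
    using character_contraction[OF \<xi> f sa_algebra_const[of 0], of "b f"] b[OF f]
      character_const[OF \<xi>, of 0] by simp
  moreover have "points (Sa G) \<subseteq> extensional A"
    unfolding points_Sa characters_def by blast
  ultimately have "points (Sa G) \<subseteq> (\<Pi>\<^sub>E f\<in>A. cball 0 (b f))"
    unfolding PiE_def by blast
  moreover have "compactin ?P (\<Pi>\<^sub>E f\<in>A. cball 0 (b f))"
    by (simp add: compactin_PiE)
  ultimately have "compactin ?P (points (Sa G))"
    using closedin_points_Sa closed_compactin by blast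
  then show ?thesis
    unfolding points_Sa unfolding flow_top_Sa by (rule compact_space_subtopology)
qed

lemma sa_embed_dense: "flow_top (Sa G) closure_of (sa_embed G ` carrier G) = points (Sa G)"
  unfolding dense_intersects_open
proof (intro allI impI, elim conjE)
  let ?P = "product_topology (\<lambda>_. euclidean) A :: ('g sa_point) topology"
  fix T
  assume T: "openin (flow_top (Sa G)) T" "T \<noteq> {}"
  then obtain W where W: "openin ?P W" "T = W \<inter> points (Sa G)"
    unfolding points_Sa unfolding flow_top_Sa openin_subtopology by blast
  obtain \<xi> where \<xi>: "\<xi> \<in> W" "\<xi> \<in> points (Sa G)"
    using T(2) W(2) by blast
  obtain B where B: "\<xi> \<in> (\<Pi>\<^sub>E f\<in>A. B f)" "\<forall>f. open (B f)" "finite {f. B f \<noteq> UNIV}"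
      "(\<Pi>\<^sub>E f\<in>A. B f) \<subseteq> W"
    using product_topology_open_contains_basis[OF W(1) \<xi>(1)] by auto
  define F where "F = {f. B f \<noteq> UNIV} \<inter> A"
  have F: "finite F" "F \<subseteq> A"
    using B(3) by (auto simp: F_def)
  have "\<forall>f\<in>F. \<exists>e>0. \<forall>z. cmod (z - \<xi> f) < e \<longrightarrow> z \<in> B f"
    using B(1,2) F(2) unfolding open_dist dist_norm by blast
  then obtain e where e: "\<And>f. f \<in> F \<Longrightarrow> e f > 0"
      "\<And>f z. f \<in> F \<Longrightarrow> cmod (z - \<xi> f) < e f \<Longrightarrow> z \<in> B f"
    by metis
  define \<epsilon> where "\<epsilon> = Min (insert 1 (e ` F))"
  have "\<epsilon> > 0"
    unfolding \<epsilon>_def using F(1) e(1) by simp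
  then obtain g where g: "g \<in> carrier G" "\<forall>f\<in>F. cmod (f g - \<xi> f) < \<epsilon>"
    by (rule character_approx[OF \<xi>(2) F])
  have "f g \<in> B f" if "f \<in> A" for f
  proof (cases "f \<in> F")
    case True
    then have "\<epsilon> \<le> e f"
      unfolding \<epsilon>_def using F(1) by simp
    then show ?thesis
      using g(2) True by (intro e(2)[OF True]) fastforce
  next
    case False
    then show ?thesis
      using that by (simp add: F_def)
  qed
  then have "sa_embed G g \<in> (\<Pi>\<^sub>E f\<in>A. B f)"
    by (simp add: sa_embed_def)
  then have "sa_embed G g \<in> T"
    using B(4) sa_embed_points[OF g(1)] W(2) by blast
  then show "sa_embed G ` carrier G \<inter> T \<noteq> {}"
    using g(1) by blast
qed

text \<open>Translation is a unital endomorphism of the algebra, and the action precomposes with it.\<close>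

lemma flow_act_Sa_points:
  assumes g: "g \<in> carrier G" and \<xi>: "\<xi> \<in> points (Sa G)"
  shows "flow_act (Sa G) g \<xi> \<in> points (Sa G)"
proof -
  let ?\<eta> = "flow_act (Sa G) g \<xi>"
  have tr: "left_translate g f \<in> A" if "f \<in> A" for f
    using left_translate_sa_algebra[OF that g] .
  have push: "left_translate g (\<lambda>h\<in>carrier G. F (f h) (k h)) =
      (\<lambda>h\<in>carrier G. F (left_translate g f h) (left_translate g k h))" for F :: "complex \<Rightarrow> complex \<Rightarrow> complex" and f k
    using g by (intro restrict_ext) simp
  have "?\<eta> \<in> extensional A"
    by (simp add: Sa_def)
  moreover have "\<exists>f\<in>A. ?\<eta> f \<noteq> 0"
  proof
    have "left_translate g (const_fun 1) = const_fun 1"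
      using g by (intro restrict_ext) simp
    then show "?\<eta> (const_fun 1) \<noteq> 0"
      using character_const[OF \<xi>, of 1] by (simp add: flow_act_Sa sa_algebra_const)
  qed (rule sa_algebra_const)
  moreover have "?\<eta> (\<lambda>h\<in>carrier G. f h + k h) = ?\<eta> f + ?\<eta> k" if "f \<in> A" "k \<in> A" for f k
    using push[of "(+)" f k] character_add[OF \<xi> tr tr] that by (simp only: flow_act_Sa sa_algebra_add)
  moreover have "?\<eta> (\<lambda>h\<in>carrier G. c * f h) = c * ?\<eta> f" if "f \<in> A" for f c
    using push[of "\<lambda>x _. c * x" f f] character_scale[OF \<xi> tr, of f c] that
    by (simp only: flow_act_Sa sa_algebra_scale)
  moreover have "?\<eta> (\<lambda>h\<in>carrier G. f h * k h) = ?\<eta> f * ?\<eta> k" if "f \<in> A" "k \<in> A" for f k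
    using push[of "(*)" f k] character_mult[OF \<xi> tr tr] that by (simp only: flow_act_Sa sa_algebra_mult)
  ultimately show ?thesis
    unfolding points_Sa characters_def by blast
qed

text \<open>Moving \<open>g\<close> to a nearby \<open>k\<close> changes the translate of \<open>f\<close> little in the supremum norm, by
  uniform continuity applied to \<open>k h = (k g\<^sup>-\<^sup>1) (g h)\<close>; by contractivity this change is small
  simultaneously at all characters. Together with continuity in the character this gives joint
  continuity.\<close>

lemma continuous_act_Sa:
  "continuous_map (prod_topology (grp_top G) (flow_top (Sa G))) (flow_top (Sa G))
     (\<lambda>(g, \<xi>). flow_act (Sa G) g \<xi>)"
proof (rule continuous_map_into_Sa)
  fix p
  assume "p \<in> topspace (prod_topology (grp_top G) (flow_top (Sa G)))"
  then show "(case p of (g, \<xi>) \<Rightarrow> flow_act (Sa G) g \<xi>) \<in> points (Sa G)"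
    using flow_act_Sa_points by auto
next
  fix f
  assume f: "f \<in> A"
  show "continuous_map (prod_topology (grp_top G) (flow_top (Sa G))) euclidean
          (\<lambda>p. (case p of (g, \<xi>) \<Rightarrow> flow_act (Sa G) g \<xi>) f)"
  proof (rule continuous_map_euclidean_epsI)
    fix p \<epsilon>
    assume p: "p \<in> topspace (prod_topology (grp_top G) (flow_top (Sa G)))" and "(\<epsilon> :: real) > 0"
    then have \<epsilon>2: "\<epsilon> / 2 > 0"
      by simp
    obtain g \<xi> where p_eq: "p = (g, \<xi>)" and g: "g \<in> carrier G" and \<xi>: "\<xi> \<in> points (Sa G)"
      using p by (cases p) simp
    obtain U where U: "openin (grp_top G) U" "\<one> \<in> U"
        "\<forall>u\<in>U. \<forall>h\<in>carrier G. cmod (f (u \<otimes> h) - f h) < \<epsilon> / 2"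
      by (rule sa_algebra_uniform[OF f \<epsilon>2])
    define V where "V = {k \<in> topspace (grp_top G). k \<otimes> inv g \<in> U}"
    have "continuous_map (grp_top G) (grp_top G) ((\<lambda>(g, h). g \<otimes> h) \<circ> (\<lambda>k. (k, inv g)))"
      using g by (intro continuous_map_compose[OF _ continuous_mult] continuous_map_pairedI
          continuous_map_id[unfolded id_def]) simp_all
    then have "continuous_map (grp_top G) (grp_top G) (\<lambda>k. k \<otimes> inv g)"
      by (simp add: comp_def)
    from openin_continuous_map_preimage[OF this U(1)] have V: "openin (grp_top G) V"
      unfolding V_def .
    define N where "N = {\<eta> \<in> points (Sa G).
        \<eta> (left_translate g f) \<in> ball (\<xi> (left_translate g f)) (\<epsilon> / 2)}"
    have N: "openin (flow_top (Sa G)) N"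
      unfolding N_def
      by (rule openin_continuous_map_preimage[OF continuous_eval[OF left_translate_sa_algebra[OF f g]]])
        simp
    have "g \<in> V" "\<xi> \<in> N"
      using g \<xi> U(2) \<epsilon>2 by (simp_all add: V_def N_def)
    moreover have "dist (flow_act (Sa G) k \<eta> f) (flow_act (Sa G) g \<xi> f) < \<epsilon>"
      if k: "k \<in> V" and \<eta>: "\<eta> \<in> N" for k \<eta>
    proof -
      have k': "k \<in> carrier G" "k \<otimes> inv g \<in> U"
        using k by (simp_all add: V_def)
      have near: "cmod (left_translate k f h - left_translate g f h) \<le> \<epsilon> / 2" if h: "h \<in> carrier G" for h
      proof -
        have "k \<otimes> h = (k \<otimes> inv g) \<otimes> (g \<otimes> h)"
          using g k'(1) h by (simp add: m_assoc inv_solve_left)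
        then have "cmod (f (k \<otimes> h) - f (g \<otimes> h)) < \<epsilon> / 2"
          using U(3) k'(2) g h by simp
        then show ?thesis
          using h by simp
      qed
      have "\<eta> \<in> points (Sa G)"
        using \<eta> by (simp add: N_def)
      then have "cmod (\<eta> (left_translate k f) - \<eta> (left_translate g f)) \<le> \<epsilon> / 2"
        by (rule character_contraction[OF _ left_translate_sa_algebra[OF f k'(1)]
              left_translate_sa_algebra[OF f g] near])
      moreover have "cmod (\<eta> (left_translate g f) - \<xi> (left_translate g f)) < \<epsilon> / 2"
        using \<eta> by (simp add: N_def dist_norm norm_minus_commute)
      ultimately have "cmod (\<eta> (left_translate k f) - \<xi> (left_translate g f)) < \<epsilon>"
        using norm_triangle_ineq[of "\<eta> (left_translate k f) - \<eta> (left_translate g f)"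
            "\<eta> (left_translate g f) - \<xi> (left_translate g f)"] by simp
      then show ?thesis
        using f by (simp only: flow_act_Sa dist_norm)
    qed
    ultimately show "\<exists>W. openin (prod_topology (grp_top G) (flow_top (Sa G))) W \<and> p \<in> W \<and>
        (\<forall>q\<in>W. dist ((case q of (g, \<xi>) \<Rightarrow> flow_act (Sa G) g \<xi>) f)
                    ((case p of (g, \<xi>) \<Rightarrow> flow_act (Sa G) g \<xi>) f) < \<epsilon>)"
      using V N unfolding p_eq
      by (intro exI[of _ "V \<times> N"]) (simp add: openin_prod_Times_iff)
  qed
qed

lemma G_flow_Sa: "G_flow G (Sa G)"
  unfolding G_flow_def
proof (intro conjI ballI compact_space_Sa Hausdorff_space_Sa continuous_act_Sa)
  show "points (Sa G) \<noteq> {}"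
    using sa_embed_points[OF one_closed] by blast
next
  fix \<xi>
  assume \<xi>: "\<xi> \<in> points (Sa G)"
  show "flow_act (Sa G) \<one> \<xi> = \<xi>"
  proof (rule character_ext[OF flow_act_Sa_points[OF one_closed \<xi>] \<xi>])
    fix f
    assume f: "f \<in> A"
    have "left_translate \<one> f = f"
      by (rule sa_algebra_ext[symmetric, OF f]) simp_all
    then show "flow_act (Sa G) \<one> \<xi> f = \<xi> f"
      using flow_act_Sa[OF f, of \<one> \<xi>] by simp
  qed
next
  fix g h \<xi>
  assume g: "g \<in> carrier G" and h: "h \<in> carrier G" and \<xi>: "\<xi> \<in> points (Sa G)"
  show "flow_act (Sa G) (g \<otimes> h) \<xi> = flow_act (Sa G) g (flow_act (Sa G) h \<xi>)"
  proof (rule character_ext)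
    fix f
    assume f: "f \<in> A"
    have "left_translate h (left_translate g f) = left_translate (g \<otimes> h) f"
      using g h by (intro restrict_ext) (simp add: m_assoc)
    then show "flow_act (Sa G) (g \<otimes> h) \<xi> f = flow_act (Sa G) g (flow_act (Sa G) h \<xi>) f"
      using left_translate_sa_algebra[OF f g] f by (simp only: flow_act_Sa)
  qed (intro flow_act_Sa_points m_closed g h \<xi>)+
qed

end

section \<open>The universal property of the Samuel compactification\<close>

context top_group
begin

lemma flow_act_Sa_embed:
  assumes "g \<in> carrier G" "h \<in> carrier G"
  shows "flow_act (Sa G) g (sa_embed G h) = sa_embed G (g \<otimes> h)"
  using assms left_translate_sa_algebra[OF _ assms(1)]
  unfolding Sa_def sa_embed_def by (intro ext) simp

text \<open>Compactness of the flow makes the continuity of the action at \<open>1\<close> uniform in the point (tube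
  lemma), hence uniform along the orbit of \<open>x\<close>.\<close>

lemma orbit_function_sa_algebra:
  fixes F :: "'x \<Rightarrow> complex"
  assumes X: "G_flow G X" and x: "x \<in> points X" and F: "continuous_map (flow_top X) euclidean F"
  shows "(\<lambda>g\<in>carrier G. F (flow_act X g x)) \<in> A"
proof (rule sa_algebraI)
  have act: "flow_act X g y \<in> points X" if "g \<in> carrier G" "y \<in> points X" for g y
    using G_flow_act_closed[OF X topspace_grp that] .
  have cpt: "compactin (flow_top X) (points X)"
    using X unfolding G_flow_def compact_space_def by blast
  have "compact (F ` points X)"
    using image_compactin[OF cpt F] by simp
  then show "bounded ((\<lambda>g\<in>carrier G. F (flow_act X g x)) ` carrier G)"
    by (rule bounded_subset[OF compact_imp_bounded]) (use act x in auto)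
  fix \<epsilon> :: real
  assume \<epsilon>: "\<epsilon> > 0"
  let ?P = "prod_topology (grp_top G) (flow_top X)"
  define D where "D = (\<lambda>p. F (flow_act X (fst p) (snd p)) - F (snd p))"
  have "continuous_map ?P (flow_top X) (\<lambda>(g, x). flow_act X g x)"
    using X unfolding G_flow_def by blast
  from continuous_map_compose[OF this F] continuous_map_compose[OF continuous_map_snd F]
  have "continuous_map ?P euclidean D"
    unfolding D_def comp_def case_prod_unfold by (rule continuous_map_diff)
  then have W: "openin ?P {p \<in> topspace ?P. D p \<in> ball 0 \<epsilon>}"
    by (rule openin_continuous_map_preimage) simp
  have one_W: "{\<one>} \<times> points X \<subseteq> {p \<in> topspace ?P. D p \<in> ball 0 \<epsilon>}"
    using X \<epsilon> unfolding G_flow_def D_def by auto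
  obtain U V where U: "openin (grp_top G) U" "\<one> \<in> U" and V: "points X \<subseteq> V"
      and UV: "U \<times> V \<subseteq> {p \<in> topspace ?P. D p \<in> ball 0 \<epsilon>}"
    using tube_lemma_right[OF W cpt _ one_W] unfolding topspace_grp by blast
  have near: "cmod (F (flow_act X u y) - F y) < \<epsilon>" if "u \<in> U" "y \<in> points X" for u y
  proof -
    have "(u, y) \<in> {p \<in> topspace ?P. D p \<in> ball 0 \<epsilon>}"
      using UV V that by blast
    then show ?thesis
      by (simp add: D_def)
  qed
  have "cmod (F (flow_act X (u \<otimes> g) x) - F (flow_act X g x)) < \<epsilon>"
    if u: "u \<in> U" and g: "g \<in> carrier G" for u g
  proof -
    have "flow_act X (u \<otimes> g) x = flow_act X u (flow_act X g x)"
      using X x g openin_grp_subset[OF U(1) u] unfolding G_flow_def by blast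
    then show ?thesis
      using near[OF u act[OF g x]] by simp
  qed
  then show "\<exists>U. openin (grp_top G) U \<and> \<one> \<in> U \<and> (\<forall>u\<in>U. \<forall>g\<in>carrier G.
      cmod ((\<lambda>g\<in>carrier G. F (flow_act X g x)) (u \<otimes> g) -
            (\<lambda>g\<in>carrier G. F (flow_act X g x)) g) < \<epsilon>)"
    using U openin_grp_subset[OF U(1)] by (intro exI[of _ U]) simp
qed simp

text \<open>A continuous \<open>F\<close> on \<open>X\<close> read along the orbit of \<open>x\<close> is an element \<open>orb F\<close> of the algebra,
  so \<open>F (p x)\<close> has to be \<open>p (orb F)\<close>. Since continuous functions separate the points of \<open>X\<close> and
  determine its topology, this equation settles uniqueness, continuity and equivariance; only the
  existence of a point with these coordinates needs compactness, through the closure of the graph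
  \<open>{(g, g x)}\<close>.\<close>

lemma ex_orbit_map:
  assumes X: "G_flow G X" and x: "x \<in> points X"
  shows "\<exists>\<phi>. G_map G (Sa G) X \<phi> \<and> (\<forall>g\<in>carrier G. \<phi> (sa_embed G g) = flow_act X g x)"
proof -
  have act: "flow_act X g y \<in> points X" if "g \<in> carrier G" "y \<in> points X" for g y
    using G_flow_act_closed[OF X topspace_grp that] .
  have cpt: "compact_space (flow_top X)" and Hd: "Hausdorff_space (flow_top X)"
    using X unfolding G_flow_def by blast+
  have cr: "completely_regular_space (flow_top X)"
    using cpt Hd compact_Hausdorff_or_regular_imp_normal_space
      normal_imp_completely_regular_space_A Hausdorff_imp_t1_space by blast
  let ?P = "prod_topology (flow_top (Sa G)) (flow_top X)"
  define orb where "orb = (\<lambda>F :: _ \<Rightarrow> complex. \<lambda>g\<in>carrier G. F (flow_act X g x))"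
  have orb: "orb F \<in> A" if "continuous_map (flow_top X) euclidean F" for F
    unfolding orb_def by (rule orbit_function_sa_algebra[OF X x that])
  define S where "S = (\<lambda>g. (sa_embed G g, flow_act X g x)) ` carrier G"
  define C where "C = ?P closure_of S"
  \<comment> \<open>Both sides are continuous in the pair and agree on \<open>S\<close>.\<close>
  have C_eval: "F y = \<xi> (orb F)"
    if "(\<xi>, y) \<in> C" and F: "continuous_map (flow_top X) euclidean F" for \<xi> y F
  proof -
    have "(F \<circ> snd) (\<xi>, y) = ((\<lambda>\<xi>. \<xi> (orb F)) \<circ> fst) (\<xi>, y)"
    proof (rule forall_in_closure_of_eq[OF that(1)[unfolded C_def]])
      show "continuous_map ?P euclidean (F \<circ> snd)"
        by (rule continuous_map_compose[OF continuous_map_snd F])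
      show "continuous_map ?P euclidean ((\<lambda>\<xi>. \<xi> (orb F)) \<circ> fst)"
        by (rule continuous_map_compose[OF continuous_map_fst continuous_eval[OF orb[OF F]]])
      show "(F \<circ> snd) p = ((\<lambda>\<xi>. \<xi> (orb F)) \<circ> fst) p" if "p \<in> S" for p
        using that orb[OF F] by (auto simp: S_def sa_embed_def orb_def)
    qed simp
    then show ?thesis
      by simp
  qed
  \<comment> \<open>The projection of the compact set \<open>C\<close> is closed and contains the dense copy of \<open>G\<close>.\<close>
  have "\<exists>y. (\<xi>, y) \<in> C" if \<xi>: "\<xi> \<in> points (Sa G)" for \<xi>
  proof -
    have "compact_space ?P"
      using cpt compact_space_Sa by (simp add: compact_space_prod_topology)
    then have "compactin ?P C"
      unfolding C_def by (intro closedin_compact_space) simp_all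
    then have "closedin (flow_top (Sa G)) (fst ` C)"
      by (intro compactin_imp_closedin[OF Hausdorff_space_Sa] image_compactin[OF _ continuous_map_fst])
    moreover have "sa_embed G ` carrier G \<subseteq> fst ` C"
    proof -
      have "S \<subseteq> topspace ?P"
        using sa_embed_points act[OF _ x] by (auto simp: S_def)
      then have "S \<subseteq> C"
        unfolding C_def by (rule closure_of_subset)
      then show ?thesis
        by (force simp: S_def)
    qed
    ultimately have "points (Sa G) \<subseteq> fst ` C"
      unfolding sa_embed_dense[symmetric] by (intro closure_of_minimal)
    then show ?thesis
      using \<xi> by force
  qed
  then obtain \<phi> where \<phi>C: "\<And>\<xi>. \<xi> \<in> points (Sa G) \<Longrightarrow> (\<xi>, \<phi> \<xi>) \<in> C"
    by metis
  have \<phi>: "\<phi> \<xi> \<in> points X" if "\<xi> \<in> points (Sa G)" for \<xi>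
    using \<phi>C[OF that] closure_of_subset_topspace[of ?P S] by (auto simp: C_def)
  have \<phi>_eval: "F (\<phi> \<xi>) = \<xi> (orb F)"
    if "\<xi> \<in> points (Sa G)" "continuous_map (flow_top X) euclidean F" for \<xi> F
    using C_eval[OF \<phi>C] that by blast
  have "continuous_map (flow_top (Sa G)) (flow_top X) \<phi>"
  proof (rule continuous_map_into_completely_regular_space[OF cr])
    fix F :: "_ \<Rightarrow> complex"
    assume F: "continuous_map (flow_top X) euclidean F"
    show "continuous_map (flow_top (Sa G)) euclidean (\<lambda>\<xi>. F (\<phi> \<xi>))"
      by (rule continuous_map_eq[OF continuous_eval[OF orb[OF F]]]) (simp add: \<phi>_eval F)
  qed (use \<phi> in blast)
  moreover have "\<phi> (flow_act (Sa G) g \<xi>) = flow_act X g (\<phi> \<xi>)"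
    if g: "g \<in> carrier G" and \<xi>: "\<xi> \<in> points (Sa G)" for g \<xi>
  proof (rule eq_if_complex_functions_agree[OF cr Hd])
    have g\<xi>: "flow_act (Sa G) g \<xi> \<in> points (Sa G)"
      by (rule flow_act_Sa_points[OF g \<xi>])
    then show "\<phi> (flow_act (Sa G) g \<xi>) \<in> points X"
      by (rule \<phi>)
    show "flow_act X g (\<phi> \<xi>) \<in> points X"
      by (rule act[OF g \<phi>[OF \<xi>]])
    fix F :: "_ \<Rightarrow> complex"
    assume F: "continuous_map (flow_top X) euclidean F"
    have "continuous_map (prod_topology (grp_top G) (flow_top X)) (flow_top X) (\<lambda>(g, x). flow_act X g x)"
      using X unfolding G_flow_def by blast
    moreover have "continuous_map (flow_top X) (prod_topology (grp_top G) (flow_top X)) (\<lambda>y. (g, y))"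
      using g by (intro continuous_map_pairedI continuous_map_id[unfolded id_def]) simp
    ultimately have "continuous_map (flow_top X) euclidean
        (F \<circ> ((\<lambda>(g, x). flow_act X g x) \<circ> (\<lambda>y. (g, y))))"
      by (intro continuous_map_compose[OF _ F] continuous_map_compose)
    then have Fg: "continuous_map (flow_top X) euclidean (\<lambda>y. F (flow_act X g y))"
      by (simp add: comp_def)
    \<comment> \<open>Acting by \<open>g\<close> on a character amounts to composing \<open>F\<close> with \<open>g\<close>.\<close>
    have "left_translate g (orb F) = orb (\<lambda>y. F (flow_act X g y))"
      using X g x unfolding orb_def G_flow_def by (intro restrict_ext) simp
    then show "F (\<phi> (flow_act (Sa G) g \<xi>)) = F (flow_act X g (\<phi> \<xi>))"
      using \<phi>_eval[OF g\<xi> F] \<phi>_eval[OF \<xi> Fg] flow_act_Sa[OF orb[OF F], of g \<xi>] by simp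
  qed
  moreover have "\<phi> (sa_embed G g) = flow_act X g x" if g: "g \<in> carrier G" for g
  proof (rule eq_if_complex_functions_agree[OF cr Hd \<phi>[OF sa_embed_points[OF g]] act[OF g x]])
    fix F :: "_ \<Rightarrow> complex"
    assume F: "continuous_map (flow_top X) euclidean F"
    show "F (\<phi> (sa_embed G g)) = F (flow_act X g x)"
      using \<phi>_eval[OF sa_embed_points[OF g] F] orb[OF F] g by (simp add: sa_embed_def orb_def)
  qed
  ultimately show ?thesis
    unfolding G_map_def by blast
qed

text \<open>The orbit of the image of \<open>1\<close> is the dense copy of \<open>G\<close>, so one value determines the map.\<close>

lemma G_map_Sa_unique:
  assumes "Hausdorff_space (flow_top X)" and \<phi>: "G_map G (Sa G) X \<phi>" and \<psi>: "G_map G (Sa G) X \<psi>"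
    and eq: "\<phi> (sa_embed G \<one>) = \<psi> (sa_embed G \<one>)" and p: "p \<in> points (Sa G)"
  shows "\<phi> p = \<psi> p"
proof -
  have "p \<in> flow_top (Sa G) closure_of (sa_embed G ` carrier G)"
    using p sa_embed_dense by simp
  then show ?thesis
  proof (rule forall_in_closure_of_eq[where Y = "flow_top X" and f = \<phi> and g = \<psi>])
    fix q
    assume "q \<in> sa_embed G ` carrier G"
    then obtain g where g: "g \<in> carrier G" "q = flow_act (Sa G) g (sa_embed G \<one>)"
      using flow_act_Sa_embed by auto
    then show "\<phi> q = \<psi> q"
      using G_map_act[OF \<phi> g(1)] G_map_act[OF \<psi> g(1)] sa_embed_points eq by simp
  qed (use assms in \<open>simp_all add: G_map_def\<close>)
qed

lemma
  assumes X: "G_flow G X" and x: "x \<in> points X"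
  shows G_map_orbit_map: "G_map G (Sa G) X (sa_orbit_map G X x)"
    and orbit_map_embed: "g \<in> carrier G \<Longrightarrow> sa_orbit_map G X x (sa_embed G g) = flow_act X g x"
proof -
  let ?R = "\<lambda>\<phi>. \<phi> \<in> extensional (points (Sa G)) \<and> G_map G (Sa G) X \<phi> \<and>
             (\<forall>g\<in>carrier G. \<phi> (sa_embed G g) = flow_act X g x)"
  obtain \<phi> where \<phi>: "G_map G (Sa G) X \<phi>" "\<forall>g\<in>carrier G. \<phi> (sa_embed G g) = flow_act X g x"
    using ex_orbit_map[OF X x] by blast
  have "continuous_map (flow_top (Sa G)) (flow_top X) (restrict \<phi> (points (Sa G)))"
    by (rule continuous_map_eq[of _ _ \<phi>]) (use \<phi>(1) in \<open>simp_all add: G_map_def\<close>)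
  then have ex: "?R (restrict \<phi> (points (Sa G)))"
    using \<phi> flow_act_Sa_points sa_embed_points unfolding G_map_def by simp
  have unique: "\<alpha> = \<beta>" if "?R \<alpha>" "?R \<beta>" for \<alpha> \<beta>
  proof (rule extensionalityI)
    fix p
    assume "p \<in> points (Sa G)"
    then show "\<alpha> p = \<beta> p"
      using X that G_map_Sa_unique[of X \<alpha> \<beta> p] unfolding G_flow_def by simp
  qed (use that in blast)+
  have "?R (sa_orbit_map G X x)"
    unfolding sa_orbit_map_def by (rule theI[of ?R, OF ex]) (rule unique[OF _ ex])
  then show "G_map G (Sa G) X (sa_orbit_map G X x)"
    "g \<in> carrier G \<Longrightarrow> sa_orbit_map G X x (sa_embed G g) = flow_act X g x"
    by blast+
qed

lemma orbit_map_one: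
  "G_flow G X \<Longrightarrow> x \<in> points X \<Longrightarrow> sa_orbit_map G X x (sa_embed G \<one>) = x"
  using orbit_map_embed[OF _ _ one_closed, of X x] unfolding G_flow_def[of G X] by simp

lemma G_map_eq_orbit_map:
  assumes X: "G_flow G X" and \<phi>: "G_map G (Sa G) X \<phi>" and p: "p \<in> points (Sa G)"
  shows "\<phi> p = sa_orbit_map G X (\<phi> (sa_embed G \<one>)) p"
proof (rule G_map_Sa_unique[OF _ \<phi> _ _ p])
  have "\<phi> (sa_embed G \<one>) \<in> points X"
    using G_map_closed[OF \<phi> sa_embed_points[OF one_closed]] .
  then show "G_map G (Sa G) X (sa_orbit_map G X (\<phi> (sa_embed G \<one>)))"
    "\<phi> (sa_embed G \<one>) = sa_orbit_map G X (\<phi> (sa_embed G \<one>)) (sa_embed G \<one>)"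
    using G_map_orbit_map[OF X] orbit_map_one[OF X] by simp_all
qed (use X in \<open>simp add: G_flow_def\<close>)

text \<open>Both sides are \<open>G\<close>-maps in \<open>p\<close> that send \<open>1\<close> to \<open>\<theta> x\<close>. For \<open>\<theta> = (\<lambda>p. p q)\<close> this is the
  associativity of the multiplication of \<open>Sa G\<close>.\<close>

lemma G_map_commutes_with_orbit_map:
  assumes X: "G_flow G X" and Y: "G_flow G Y" and \<theta>: "G_map G X Y \<theta>"
    and x: "x \<in> points X" and p: "p \<in> points (Sa G)"
  shows "\<theta> (sa_orbit_map G X x p) = sa_orbit_map G Y (\<theta> x) p"
  using G_map_eq_orbit_map[OF Y G_map_compose[OF G_map_orbit_map[OF X x] \<theta>] p]
    orbit_map_one[OF X x] by simp

lemma orbit_map_surj: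
  assumes X: "G_flow G X" and x: "x \<in> points X"
    and dense: "flow_top X closure_of ((\<lambda>g. flow_act X g x) ` carrier G) = points X"
  shows "sa_orbit_map G X x ` points (Sa G) = points X"
proof
  let ?m = "sa_orbit_map G X x"
  note m = G_map_orbit_map[OF X x]
  show "?m ` points (Sa G) \<subseteq> points X"
    using G_map_closed[OF m] by blast
  have "compactin (flow_top X) (?m ` points (Sa G))"
    using m compact_space_Sa unfolding G_map_def compact_space_def
    by (intro image_compactin[of "flow_top (Sa G)"]) simp_all
  then have "closedin (flow_top X) (?m ` points (Sa G))"
    using X unfolding G_flow_def by (intro compactin_imp_closedin) simp_all
  moreover have "(\<lambda>g. flow_act X g x) ` carrier G \<subseteq> ?m ` points (Sa G)"
    using orbit_map_embed[OF X x] sa_embed_points by (metis image_subsetI imageI)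
  ultimately show "points X \<subseteq> ?m ` points (Sa G)"
    unfolding dense[symmetric] by (intro closure_of_minimal)
qed

lemma point_transitive_Sa: "point_transitive G (Sa G)"
proof -
  have "(\<lambda>g. flow_act (Sa G) g (sa_embed G \<one>)) ` carrier G = sa_embed G ` carrier G"
    using flow_act_Sa_embed[OF _ one_closed] by (intro image_cong) simp_all
  then show ?thesis
    unfolding point_transitive_def
    using sa_embed_points[OF one_closed] sa_embed_dense by metis
qed


section \<open>Left ideals and projectivity\<close>

context
  fixes q
  assumes q: "q \<in> points (Sa G)"
begin

lemma points_sa_left_ideal:
  "points (sa_left_ideal G q) = sa_orbit_map G (Sa G) q ` points (Sa G)"
  using G_map_closed[OF G_map_orbit_map[OF G_flow_Sa q]]
  unfolding sa_left_ideal_def sa_mult_def by auto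

lemma sa_left_ideal_subset: "points (sa_left_ideal G q) \<subseteq> points (Sa G)"
  using G_map_closed[OF G_map_orbit_map[OF G_flow_Sa q]] unfolding points_sa_left_ideal by blast

lemma flow_top_sa_left_ideal:
  "flow_top (sa_left_ideal G q) =
     subtopology (flow_top (Sa G)) (sa_orbit_map G (Sa G) q ` points (Sa G))"
  unfolding sa_left_ideal_def sa_mult_def by simp

lemma flow_act_sa_left_ideal [simp]: "flow_act (sa_left_ideal G q) = flow_act (Sa G)"
  unfolding sa_left_ideal_def by simp

lemma G_map_into_left_ideal:
  assumes "G_map G X (Sa G) \<phi>" "\<phi> ` points X \<subseteq> points (sa_left_ideal G q)"
  shows "G_map G X (sa_left_ideal G q) \<phi>"
  using assms unfolding points_sa_left_ideal G_map_def flow_act_sa_left_ideal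
  unfolding flow_top_sa_left_ideal continuous_map_in_subtopology by blast

lemma G_map_from_left_ideal:
  assumes "G_map G (Sa G) X \<phi>"
  shows "G_map G (sa_left_ideal G q) X \<phi>"
proof -
  have "continuous_map (flow_top (sa_left_ideal G q)) (flow_top X) \<phi>"
    unfolding flow_top_sa_left_ideal
    using assms unfolding G_map_def by (intro continuous_map_from_subtopology) simp
  then show ?thesis
    using G_map_act[OF assms] sa_left_ideal_subset unfolding G_map_def flow_act_sa_left_ideal by blast
qed

lemma G_map_onto_left_ideal: "G_map G (Sa G) (sa_left_ideal G q) (sa_orbit_map G (Sa G) q)"
  by (intro G_map_into_left_ideal G_map_orbit_map G_flow_Sa q) (simp add: points_sa_left_ideal)

lemma G_flow_left_ideal: "G_flow G (sa_left_ideal G q)"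
proof -
  let ?L = "sa_left_ideal G q"
  note m = G_map_onto_left_ideal
  have sub: "p \<in> points (Sa G)" if "p \<in> points ?L" for p
    using that sa_left_ideal_subset by blast
  have act: "flow_act (Sa G) g p \<in> points ?L" if g: "g \<in> carrier G" and p: "p \<in> points ?L" for g p
  proof -
    obtain p' where p': "p' \<in> points (Sa G)" "p = sa_orbit_map G (Sa G) q p'"
      using p unfolding points_sa_left_ideal by blast
    show ?thesis
      using G_map_act[OF m g p'(1)] G_map_closed[OF m flow_act_Sa_points[OF g p'(1)]] p'(2)
      by simp
  qed
  have "points ?L \<noteq> {}"
    using q unfolding points_sa_left_ideal by blast
  moreover have "compact_space (flow_top ?L)"
    using G_map_orbit_map[OF G_flow_Sa q] compact_space_Sa
    unfolding flow_top_sa_left_ideal G_map_def compact_space_def[of "flow_top (Sa G)"]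
    by (intro compact_space_subtopology image_compactin[of "flow_top (Sa G)"]) simp_all
  moreover have "Hausdorff_space (flow_top ?L)"
    unfolding flow_top_sa_left_ideal by (intro Hausdorff_space_subtopology Hausdorff_space_Sa)
  moreover have "continuous_map (prod_topology (grp_top G) (flow_top ?L)) (flow_top ?L)
      (\<lambda>(g, p). flow_act (Sa G) g p)"
  proof -
    have "continuous_map (prod_topology (grp_top G) (flow_top ?L)) (flow_top (Sa G))
        (\<lambda>(g, p). flow_act (Sa G) g p)"
      unfolding flow_top_sa_left_ideal prod_topology_subtopology
      by (intro continuous_map_from_subtopology continuous_act_Sa)
    moreover have "(\<lambda>(g, p). flow_act (Sa G) g p) \<in>
        topspace (prod_topology (grp_top G) (flow_top ?L)) \<rightarrow> points ?L"
      using act by auto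
    ultimately show ?thesis
      unfolding points_sa_left_ideal
      by (subst (2) flow_top_sa_left_ideal) (simp only: continuous_map_in_subtopology image_subset_iff_funcset)
  qed
  ultimately show ?thesis
    using G_flow_Sa sub unfolding G_flow_def flow_act_sa_left_ideal by simp
qed

lemma point_transitive_left_ideal: "point_transitive G (sa_left_ideal G q)"
  by (rule point_transitive_image[OF G_map_onto_left_ideal _ point_transitive_Sa])
    (simp add: points_sa_left_ideal)

end

text \<open>By associativity, \<open>(p \<rho>) \<rho> = p (\<rho> \<rho>) = p \<rho>\<close>.\<close>

lemma idempotent_right_identity:
  assumes \<rho>: "sa_idempotent G \<rho>" and p: "p \<in> points (sa_left_ideal G \<rho>)"
  shows "sa_orbit_map G (Sa G) \<rho> p = p"
proof -
  let ?m = "sa_orbit_map G (Sa G) \<rho>"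
  have \<rho>S: "\<rho> \<in> points (Sa G)" and \<rho>\<rho>: "?m \<rho> = \<rho>"
    using \<rho> unfolding sa_idempotent_def sa_mult_def by blast+
  obtain p' where p': "p' \<in> points (Sa G)" "p = ?m p'"
    using p unfolding points_sa_left_ideal[OF \<rho>S] by blast
  have "?m (?m p') = sa_orbit_map G (Sa G) (?m \<rho>) p'"
    by (rule G_map_commutes_with_orbit_map[OF G_flow_Sa G_flow_Sa
          G_map_orbit_map[OF G_flow_Sa \<rho>S] \<rho>S p'(1)])
  then show ?thesis
    using \<rho>\<rho> p'(2) by simp
qed

text \<open>The lift exists on all of \<open>Sa G\<close>, as \<open>p \<mapsto> p z\<close> for any \<open>z\<close> over \<open>\<phi> \<rho>\<close>. Idempotency enters
  when it is compared with \<open>\<phi>\<close> on the ideal: \<open>\<phi> p = \<phi> (p \<rho>) = p (\<phi> \<rho>)\<close>.\<close>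

lemma G_projective_left_ideal:
  assumes \<rho>: "sa_idempotent G \<rho>"
  shows "G_projective U G (sa_left_ideal G \<rho>)"
  unfolding G_projective_def
proof (intro allI impI, elim conjE)
  fix Y Z :: "('g, 'u) flow" and \<phi> \<pi>
  let ?L = "sa_left_ideal G \<rho>"
  let ?m = "sa_orbit_map G (Sa G) \<rho>"
  assume Y: "G_flow G Y" and Z: "G_flow G Z" and \<phi>: "G_map G ?L Y \<phi>"
    and \<pi>: "G_map G Z Y \<pi>" "\<pi> ` points Z = points Y"
  have \<rho>S: "\<rho> \<in> points (Sa G)" and "?m \<rho> = \<rho>"
    using \<rho> unfolding sa_idempotent_def sa_mult_def by blast+
  then have \<rho>L: "\<rho> \<in> points ?L"
    unfolding points_sa_left_ideal[OF \<rho>S] by (metis imageI)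
  then obtain z where z: "z \<in> points Z" "\<pi> z = \<phi> \<rho>"
    using G_map_closed[OF \<phi>] \<pi>(2) by (metis imageE)
  have "\<pi> (sa_orbit_map G Z z p) = \<phi> p" if p: "p \<in> points ?L" for p
  proof -
    have pS: "p \<in> points (Sa G)"
      using p sa_left_ideal_subset[OF \<rho>S] by blast
    have "\<phi> p = (\<phi> \<circ> ?m) p"
      using idempotent_right_identity[OF \<rho> p] by simp
    also have "\<dots> = sa_orbit_map G Y (\<phi> \<rho>) p"
      using G_map_eq_orbit_map[OF Y G_map_compose[OF G_map_onto_left_ideal[OF \<rho>S] \<phi>] pS]
        orbit_map_one[OF G_flow_Sa \<rho>S] by simp
    also have "\<dots> = \<pi> (sa_orbit_map G Z z p)"
      using G_map_commutes_with_orbit_map[OF Z Y \<pi>(1) z(1) pS] z(2) by simp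
    finally show ?thesis
      by simp
  qed
  then show "\<exists>\<psi>. G_map G ?L Z \<psi> \<and> (\<forall>p\<in>points ?L. \<pi> (\<psi> p) = \<phi> p)"
    using G_map_from_left_ideal[OF \<rho>S G_map_orbit_map[OF Z z(1)]] by blast
qed

text \<open>The section of \<open>p \<mapsto> p x\<close> provided by projectivity identifies \<open>X\<close> with its image in \<open>Sa G\<close>.\<close>

lemma point_transitive_projective_is_left_ideal:
  fixes X :: "('g, 'x) flow"
  assumes X: "G_flow G X" "point_transitive G X" "G_projective TYPE('u) G X"
    and large: "points (Sa G) \<lesssim> (UNIV :: 'u set)"
  obtains \<rho> where "sa_idempotent G \<rho>" "flow_isomorphic G X (sa_left_ideal G \<rho>)"
proof -
  obtain x where x: "x \<in> points X"
      "flow_top X closure_of ((\<lambda>g. flow_act X g x) ` carrier G) = points X"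
    using X(2) unfolding point_transitive_def by blast
  let ?\<pi> = "sa_orbit_map G X x"
  note \<pi> = G_map_orbit_map[OF X(1) x(1)] and surj = orbit_map_surj[OF X(1) x]
  have "points X \<lesssim> points (Sa G)"
    using image_lepoll[of ?\<pi> "points (Sa G)"] surj by simp
  then have "points X \<lesssim> (UNIV :: 'u set)"
    using large lepoll_trans by blast
  moreover have "G_map G X X id"
    by (simp add: G_map_def)
  ultimately obtain \<psi> where \<psi>: "G_map G X (Sa G) \<psi>"
      and \<pi>\<psi>: "\<And>y. y \<in> points X \<Longrightarrow> ?\<pi> (\<psi> y) = id y"
    using G_projective_lift[OF X(3) topspace_grp X(1) _ G_flow_Sa large _ \<pi> surj] by blast
  define \<rho> where "\<rho> = \<psi> x"
  have \<rho>S: "\<rho> \<in> points (Sa G)"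
    unfolding \<rho>_def by (rule G_map_closed[OF \<psi> x(1)])
  have \<psi>\<pi>: "\<psi> (?\<pi> p) = sa_orbit_map G (Sa G) \<rho> p" if "p \<in> points (Sa G)" for p
    unfolding \<rho>_def by (rule G_map_commutes_with_orbit_map[OF X(1) G_flow_Sa \<psi> x(1) that])
  have "\<psi> (?\<pi> \<rho>) = \<rho>"
    using \<pi>\<psi>[OF x(1)] by (simp add: \<rho>_def)
  then have idem: "sa_idempotent G \<rho>"
    using \<psi>\<pi>[OF \<rho>S] \<rho>S by (simp add: sa_idempotent_def sa_mult_def)
  have image: "points (sa_left_ideal G \<rho>) = \<psi> ` points X"
    unfolding points_sa_left_ideal[OF \<rho>S] surj[symmetric] image_image
    by (intro image_cong) (simp_all add: \<psi>\<pi>)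
  have "flow_isomorphic G X (sa_left_ideal G \<rho>)"
    unfolding flow_isomorphic_def
    using G_map_into_left_ideal[OF \<rho>S \<psi>] G_map_from_left_ideal[OF \<rho>S \<pi>] \<pi>\<psi>
    by (intro exI[of _ \<psi>] exI[of _ ?\<pi>]) (simp add: image)
  with idem show ?thesis
    by (rule that)
qed

end

theorem corollary3p24:
  fixes G :: "('g, 'm) topgroup_scheme"
    and X :: "('g, 'x) flow"
  assumes polish: "polish_group G"
    and large_universe: "points (Sa G) \<lesssim> (UNIV :: 'u set)"
  shows "(\<forall>\<rho>. sa_idempotent G \<rho> \<longrightarrow>
            G_flow G (sa_left_ideal G \<rho>) \<and>
            point_transitive G (sa_left_ideal G \<rho>) \<and>
            G_projective TYPE('u) G (sa_left_ideal G \<rho>)) \<and>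
         (G_flow G X \<longrightarrow>
            (point_transitive G X \<and> G_projective TYPE('u) G X \<longleftrightarrow>
             (\<exists>\<rho>. sa_idempotent G \<rho> \<and> flow_isomorphic G X (sa_left_ideal G \<rho>))))"
proof -
  interpret top_group G
    using polish by unfold_locales (simp add: polish_group_def)
  have ideal: "G_flow G (sa_left_ideal G \<rho>)" "point_transitive G (sa_left_ideal G \<rho>)"
      "G_projective TYPE('u) G (sa_left_ideal G \<rho>)" if "sa_idempotent G \<rho>" for \<rho>
    using that G_flow_left_ideal point_transitive_left_ideal G_projective_left_ideal
    unfolding sa_idempotent_def by blast+
  have "point_transitive G X \<and> G_projective TYPE('u) G X"
    if \<rho>: "sa_idempotent G \<rho>" and iso: "flow_isomorphic G X (sa_left_ideal G \<rho>)" for \<rho>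
  proof
    obtain \<psi> where "G_map G (sa_left_ideal G \<rho>) X \<psi>" "\<psi> ` points (sa_left_ideal G \<rho>) = points X"
      using flow_isomorphic_imp_surj[OF flow_isomorphic_sym[OF iso]] by blast
    then show "point_transitive G X"
      using point_transitive_image ideal(2)[OF \<rho>] by blast
    show "G_projective TYPE('u) G X"
      using G_projective_isomorphic[OF flow_isomorphic_sym[OF iso] ideal(3)[OF \<rho>]] .
  qed
  moreover have "\<exists>\<rho>. sa_idempotent G \<rho> \<and> flow_isomorphic G X (sa_left_ideal G \<rho>)"
    if "G_flow G X" "point_transitive G X" "G_projective TYPE('u) G X"
    using point_transitive_projective_is_left_ideal[OF that large_universe] by blast
  ultimately show ?thesis
    using ideal by blast
qed

end
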